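(* Let $\mathcal{SG}^{\phi}$ be the product of a partially observable stochastic game with a deterministic Rabin automaton for an LTL formula $\phi$, and for finite state controllers $\mathcal{C}_d$ (defender) and $\mathcal{C}_a$ (adversary) let $\mathcal{M}=\mathcal{M}^{\phi,\mathcal{C}_d,\mathcal{C}_a}$ be the resulting global Markov chain. Then $$\max_{\mathcal{C}_d}\min_{\mathcal{C}_a}\mathbb{P}(\mathcal{M}\models\phi)=\max_{\mathcal{C}_d}\min_{\mathcal{C}_a}\mathbb{P}(\mathcal{SG}^{\phi}\models\phi\mid\mathcal{C}_d,\mathcal{C}_a)=\max_{\mathcal{C}_d}\min_{\mathcal{C}_a}\sum_{R\in\phi\text{-}RecSets^{\mathcal{C}_d,\mathcal{C}_a}}\mathbb{P}(\pi\to R),$$ where $\pi\to R$ is the event that a path $\pi$ of $\mathcal{M}$ (started at the initial state $\bar s_0$) reaches $R$.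
   Context: **POSG.** A partially observable stochastic game is $\mathcal{SG}=(S,s_0,U_d,U_a,\mathbb{T},\mathcal{O}_d,\mathcal{O}_a,O_d,O_a,\mathcal{AP},\mathcal{L})$: $S$ is a finite state set with initial state $s_0$; $U_d,U_a$ are finite action sets of defender and adversary; $\mathbb{T}(s'|s,u_d,u_a)$ are transition probabilities; $\mathcal{O}_d,\mathcal{O}_a$ are finite observation sets; $O_*(o|s)$, $*\in\{d,a\}$, is the probability of observing $o\in\mathcal{O}_*$ in state $s$; $\mathcal{L}:S\to 2^{\mathcal{AP}}$ is a labeling by atomic propositions. **Rabin automaton.** $\phi$ is represented by a deterministic Rabin automaton $(Q,2^{\mathcal{AP}},\delta,q_0,F)$ with finite $Q$, $\delta:Q\times 2^{\mathcal{AP}}\to Q$, and $F=\{(L(i),K(i))\}_{i=1}^M$, $L(i),K(i)\subseteq Q$. A run is accepting if for some $i$ it visits $L(i)$ finitely many times and $K(i)$ infinitely often. **Product-POSG.** $\mathcal{SG}^\phi$ has states $S^\phi=S\times Q$, initial state $(s_0,q_0)$, observation functions $O_*(o|(s,q))=O_*(o|s)$, transitions $\mathbb{T}^\phi((s',q')|(s,q),u_d,u_a)=\mathbb{T}(s'|s,u_d,u_a)$ if $\delta(q,\mathcal{L}(s'))=q'$ and $0$ otherwise, and acceptance pairs $(L^\phi(i),K^\phi(i))$ with $(s,q)\in L^\phi(i)$ iff $q\in L(i)$ and $(s,q)\in K^\phi(i)$ iff $q\in K(i)$. **Finite state controller (FSC).** $\mathcal{C}_*=(G_*,g_{0_*},\mu_*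 )$, $*\in\{d,a\}$: $G_*$ is a finite set of internal states with initial state $g_{0_*}$, and $\mu_*(g'_*,u_*|g_*,o_* )$ is, for each $(g_*,o_* )\in G_*\times\mathcal{O}_*$, a probability distribution over $(g'_*,u_* )\in G_*\times U_*$. The maximum and minimum range over all defender and adversary FSCs respectively (no sizes are fixed), and are read as supremum and infimum if not attained. **Global Markov chain (GMC).** $\mathcal{M}$ has state space $\bar S=S^\phi\times G_d\times G_a$, initial state $\bar s_0=(s_0,q_0,g_{0_d},g_{0_a})$ and transition probabilities $$\bar{\mathbb{T}}((s',q'),g'_d,g'_a|(s,q),g_d,g_a)=\sum_{o\in\mathcal{O}_d}\sum_{o'\in\mathcal{O}_a}\sum_{u_d}\sum_{u_a}O_d(o|s)O_a(o'|s)\mu_d(g'_d,u_d|g_d,o)\mu_a(g'_a,u_a|g_a,o')\mathbb{T}^\phi((s',q')|(s,q),u_d,u_a).$$ A path of $\mathcal{M}$ is accepting if for some $i$ its $S^\phi$-component visits $L^\phi(i)$ finitely often and $K^\phi(i)$ infinitely often. $\mathbb{P}(\mathcal{M}\models\phi)$ is the probability, under the usual path measure of $\mathcal{M}$ from $\bar s_0$, of the set of accepting paths; $\mathbb{P}(\mathcal{SG}^\phi\models\phi\mid\mathcal{C}_d,\mathcal{C}_a)$ is the probability that the execution of $\mathcal{SG}^\phi$ controlled by $\mathcal{C}_d,\mathcal{C}_a$ yields an accepting run of the Rabin automaton, i.e. the same quantity. **$\phi$-feasible recurrent sets.** The recurrent states of $\mathcal{M}$ are partitioned into maximal recurrence classes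 $R_1,\dots,R_p$ (all states within a class communicate). For a class $R_k$, $R_k^S\subseteq S^\phi$ is the set of $(s,q)$-components of its states. $R_k$ is $\phi$-feasible if there is $i$ with $K^\phi(i)\cap R_k^S\neq\emptyset$ and $L^\phi(i)\cap R_k^S=\emptyset$. $\phi\text{-}RecSets^{\mathcal{C}_d,\mathcal{C}_a}$ is the set of $\phi$-feasible recurrence classes. *)

theory Defs
  imports "HOL-Probability.Probability"
begin

section \<open>Linear temporal logic and deterministic Rabin automata\<close>

datatype 'ap ltl =
    LTrue
  | LAtom 'ap
  | LNot "'ap ltl"
  | LAnd "'ap ltl" "'ap ltl"
  | LNext "'ap ltl"
  | LUntil "'ap ltl" "'ap ltl"

primrec ltl_sat :: "(nat \<Rightarrow> 'ap set) \<Rightarrow> 'ap ltl \<Rightarrow> bool" where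
  "ltl_sat w LTrue \<longleftrightarrow> True"
| "ltl_sat w (LAtom p) \<longleftrightarrow> p \<in> w 0"
| "ltl_sat w (LNot f) \<longleftrightarrow> \<not> ltl_sat w f"
| "ltl_sat w (LAnd f g) \<longleftrightarrow> ltl_sat w f \<and> ltl_sat w g"
| "ltl_sat w (LNext f) \<longleftrightarrow> ltl_sat (\<lambda>n. w (n + 1)) f"
| "ltl_sat w (LUntil f g) \<longleftrightarrow>
     (\<exists>j. ltl_sat (\<lambda>n. w (n + j)) g \<and> (\<forall>i<j. ltl_sat (\<lambda>n. w (n + i)) f))"

text \<open>An acceptance pair \<open>(L, K)\<close> asks that \<open>L\<close> be visited finitely often and \<open>K\<close> infinitely often.\<close>

definition rabin_accepting :: "('a set \<times> 'a set) set \<Rightarrow> (nat \<Rightarrow> 'a) \<Rightarrow> bool" where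
  "rabin_accepting F r \<longleftrightarrow> (\<exists>(L, K)\<in>F. finite {n. r n \<in> L} \<and> infinite {n. r n \<in> K})"

record ('q, 'ap) dra =
  dra_init :: 'q
  dra_delta :: "'q \<Rightarrow> 'ap set \<Rightarrow> 'q"
  dra_pairs :: "('q set \<times> 'q set) set"

definition dra_run :: "('q, 'ap) dra \<Rightarrow> (nat \<Rightarrow> 'ap set) \<Rightarrow> (nat \<Rightarrow> 'q) \<Rightarrow> bool" where
  "dra_run A w r \<longleftrightarrow> r 0 = dra_init A \<and> (\<forall>n. r (Suc n) = dra_delta A (r n) (w n))"

definition dra_represents :: "('q, 'ap) dra \<Rightarrow> 'ap ltl \<Rightarrow> bool" where
  "dra_represents A \<phi> \<longleftrightarrow>
     (\<forall>w. ltl_sat w \<phi> \<longleftrightarrow> (\<exists>r. dra_run A w r \<and> rabin_accepting (dra_pairs A) r))"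


section \<open>Path measure of a Markov chain\<close>

text \<open>
  The path measure for initial distribution \<open>p\<close> and transition kernel \<open>K\<close> is obtained from the
  Ionescu-Tulcea theorem. Every coordinate carries the discrete sigma-algebra.
\<close>

definition path_kernel :: "'a pmf \<Rightarrow> ('a \<Rightarrow> 'a pmf) \<Rightarrow> nat \<Rightarrow> (nat \<Rightarrow> 'a) \<Rightarrow> 'a measure" where
  "path_kernel p K n \<omega> = (case n of 0 \<Rightarrow> measure_pmf p | Suc m \<Rightarrow> measure_pmf (K (\<omega> m)))"

interpretation path: Ionescu_Tulcea "path_kernel p K" "\<lambda>_. count_space UNIV" for p K
proof (rule Ionescu_Tulcea.intro)
  fix i :: nat
  show "path_kernel p K i \<in> measurable (PiM {0..<i} (\<lambda>_. count_space UNIV))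
      (subprob_algebra (count_space UNIV))"
  proof (cases i)
    case 0
    have "(\<lambda>_. measure_pmf p) \<in> measurable (PiM {0..<i} (\<lambda>_. count_space UNIV))
        (subprob_algebra (count_space UNIV))"
      by (rule measurable_const) (simp add: space_subprob_algebra measure_pmf.subprob_space_axioms)
    then show ?thesis
      unfolding 0 path_kernel_def nat.case .
  next
    case (Suc m)
    have "(\<lambda>\<omega>. \<omega> m) \<in> measurable (PiM {0..<i} (\<lambda>_. count_space UNIV)) (count_space (UNIV :: 'a set))"
      by (rule measurable_component_singleton) (simp add: Suc)
    moreover have "(\<lambda>x. measure_pmf (K x)) \<in> measurable (count_space UNIV) (subprob_algebra (count_space UNIV))"
      by (auto simp: space_subprob_algebra measure_pmf.subprob_space_axioms)
    ultimately show ?thesis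
      unfolding Suc path_kernel_def nat.case by (rule measurable_compose)
  qed
next
  fix i :: nat and x
  show "prob_space (path_kernel p K i x)"
    by (cases i) (simp_all add: path_kernel_def measure_pmf.prob_space_axioms)
qed

definition path_measure :: "'a pmf \<Rightarrow> ('a \<Rightarrow> 'a pmf) \<Rightarrow> (nat \<Rightarrow> 'a) measure" where
  "path_measure p K = path.PF.lim p K"

lemma sets_path_measure [measurable_cong]:
  "sets (path_measure p K) = sets (PiM UNIV (\<lambda>_. count_space UNIV))"
  by (simp add: path_measure_def)

lemma space_path_measure [simp]: "space (path_measure p K) = UNIV"
  by (simp add: path_measure_def space_PiM)

lemma emeasure_path_prefix:
  "emeasure (path.C p K 0 n (\<lambda>_. undefined)) (PiE {0..<n} (\<lambda>i. {x i})) =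
     (\<Prod>i<n. emeasure (path_kernel p K i x) {x i})"
proof (induction n)
  case 0
  then show ?case
    by (simp add: space_PiM sets_PiM_empty)
next
  case (Suc n)
  let ?M = "\<lambda>J. PiM J (\<lambda>_. count_space (UNIV :: 'a set))"
  let ?X = "\<lambda>n. PiE {0..<n} (\<lambda>i. {x i})"
  have X[measurable]: "?X m \<in> sets (?M {0..<m})" for m
    by (intro sets_PiM_I_finite) auto
  have *: "emeasure (path.eP p K n \<omega>) (?X (Suc n)) =
      indicator (?X n) \<omega> * emeasure (path_kernel p K n x) {x n}" if "\<omega> \<in> space (?M {0..<n})" for \<omega>
  proof -
    have ext: "\<omega> \<in> extensional {0..<n}"
      using that by (auto simp: space_PiM PiE_def)
    have "fun_upd \<omega> n -` ?X (Suc n) = (if \<omega> \<in> ?X n then {x n} else {})"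
      using ext by (auto simp: PiE_iff extensional_def fun_upd_def less_Suc_eq split: if_splits)
    moreover have "path_kernel p K n \<omega> = path_kernel p K n x" if "\<omega> \<in> ?X n"
      using that by (cases n) (auto simp: path_kernel_def PiE_iff)
    ultimately show ?thesis
      by (subst path.emeasure_eP[OF that X]) (auto simp: indicator_def)
  qed
  have "emeasure (path.C p K 0 (Suc n) (\<lambda>_. undefined)) (?X (Suc n)) =
     (\<integral>\<^sup>+\<omega>. emeasure (path.eP p K n \<omega>) (?X (Suc n)) \<partial>path.C p K 0 n (\<lambda>_. undefined))"
    using path.measurable_eP[of p K n]
    by (simp, subst emeasure_bind[where N = "?M {0..<Suc n}"])
      (auto simp: path.space_C space_PiM measurable_cong_sets[OF path.sets_C refl])
  also have "\<dots> = (\<integral>\<^sup>+\<omega>. indicator (?X n) \<omega> * emeasure (path_kernel p K n x) {x n}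
      \<partial>path.C p K 0 n (\<lambda>_. undefined))"
    by (intro nn_integral_cong *) (auto simp: path.space_C space_PiM)
  also have "\<dots> = emeasure (path.C p K 0 n (\<lambda>_. undefined)) (?X n) * emeasure (path_kernel p K n x) {x n}"
    using X[of n] by (subst nn_integral_multc) (auto simp: path.sets_C space_PiM measurable_cong_sets[OF path.sets_C refl])
  finally show ?case
    using Suc.IH by (simp add: lessThan_Suc mult.commute)
qed

lemma prob_space_path_measure: "prob_space (path_measure p K)"
proof
  let ?S = "space (PiM {} (\<lambda>_. count_space UNIV)) :: (nat \<Rightarrow> 'a) set"
  interpret prob_space "path.CI p K {}"
    by (rule path.PF.prob_space_P) simp_all
  have "emeasure (path_measure p K) (path.PF.emb UNIV {} ?S) = emeasure (path.CI p K {}) ?S"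
    unfolding path_measure_def by (rule path.lim) auto
  also have "?S = space (path.CI p K {})"
    by (simp add: path.CI_def)
  moreover have "path.PF.emb UNIV {} ?S = space (path_measure p K)"
    by (auto simp: prod_emb_def space_PiM)
  ultimately show "emeasure (path_measure p K) (space (path_measure p K)) = 1"
    by (simp only: emeasure_space_1)
qed

text \<open>The defining property of the path measure.\<close>

lemma path_measure_cylinder:
  "measure (path_measure p K) {\<omega>. \<forall>i\<le>n. \<omega> i = x i} =
     pmf p (x 0) * (\<Prod>i<n. pmf (K (x i)) (x (Suc i)))"
proof -
  let ?X = "PiE {0..<Suc n} (\<lambda>i. {x i})"
  have X: "?X \<in> sets (PiM {0..<Suc n} (\<lambda>_. count_space UNIV))"
    by (intro sets_PiM_I_finite) auto
  have "{\<omega>. \<forall>i\<le>n. \<omega> i = x i} = path.PF.emb UNIV {0..<Suc n} ?X"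
    by (auto simp: prod_emb_def PiE_iff less_Suc_eq_le)
  then have "emeasure (path_measure p K) {\<omega>. \<forall>i\<le>n. \<omega> i = x i} =
      emeasure (path.C p K 0 (Suc n) (\<lambda>_. undefined)) (path.PF.emb {0..<Suc n} {0..<Suc n} ?X)"
    unfolding path_measure_def using X by (simp only: path.lim path.emeasure_CI finite_atLeastLessThan subset_refl)
  also have "path.PF.emb {0..<Suc n} {0..<Suc n} ?X = ?X"
    using sets.sets_into_space[OF X] by (intro prod_emb_id) (auto simp: space_PiM)
  also have "emeasure (path.C p K 0 (Suc n) (\<lambda>_. undefined)) ?X =
      (\<Prod>i<Suc n. emeasure (path_kernel p K i x) {x i})"
    by (rule emeasure_path_prefix)
  also have "\<dots> = ennreal (pmf p (x 0) * (\<Prod>i<n. pmf (K (x i)) (x (Suc i))))"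
    by (subst prod.lessThan_Suc_shift)
      (simp add: path_kernel_def emeasure_pmf_single prod_ennreal prod_nonneg ennreal_mult)
  finally show ?thesis
    by (simp add: measure_def prod_nonneg)
qed


section \<open>Partially observable stochastic games and their products with a Rabin automaton\<close>

text \<open>
  The finite sets of states, actions and observations are the universes of types of class
  \<^class>\<open>finite\<close>; this constraint is imposed where it is used.
\<close>

record ('s, 'ud, 'ua, 'od, 'oa) game =
  g_init :: 's
  g_trans :: "'s \<Rightarrow> 'ud \<Rightarrow> 'ua \<Rightarrow> 's pmf"
  g_obs_d :: "'s \<Rightarrow> 'od pmf"
  g_obs_a :: "'s \<Rightarrow> 'oa pmf"

record ('s, 'ud, 'ua, 'od, 'oa, 'ap) posg = "('s, 'ud, 'ua, 'od, 'oa) game" +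
  g_label :: "'s \<Rightarrow> 'ap set"

record ('s, 'ud, 'ua, 'od, 'oa) rabin_game = "('s, 'ud, 'ua, 'od, 'oa) game" +
  g_pairs :: "('s set \<times> 's set) set"

definition product_prob ::
    "('s, 'ud, 'ua, 'od, 'oa, 'ap) posg \<Rightarrow> ('q, 'ap) dra \<Rightarrow> 's \<times> 'q \<Rightarrow> 'ud \<Rightarrow> 'ua \<Rightarrow> 's \<times> 'q \<Rightarrow> real" where
  "product_prob G A = (\<lambda>(s, q) ud ua (s', q').
     if dra_delta A q (g_label G s') = q' then pmf (g_trans G s ud ua) s' else 0)"

definition product_game ::
    "('s, 'ud, 'ua, 'od, 'oa, 'ap) posg \<Rightarrow> ('q, 'ap) dra \<Rightarrow> ('s \<times> 'q, 'ud, 'ua, 'od, 'oa) rabin_game" where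
  "product_game G A =
     \<lparr> g_init = (g_init G, dra_init A),
       g_trans = (\<lambda>x ud ua. embed_pmf (product_prob G A x ud ua)),
       g_obs_d = (\<lambda>(s, q). g_obs_d G s),
       g_obs_a = (\<lambda>(s, q). g_obs_a G s),
       g_pairs = {({(s, q). q \<in> L}, {(s, q). q \<in> K}) | L K. (L, K) \<in> dra_pairs A} \<rparr>"

lemma embed_pmf_pmf: "embed_pmf (pmf p) = p"
  using type_definition.Rep_inverse[OF td_pmf_embed_pmf] .

lemma product_prob_eq_pmf:
  fixes G :: "('s, 'ud, 'ua, 'od, 'oa, 'ap) posg" and A :: "('q, 'ap) dra"
  shows "product_prob G A (s, q) ud ua =
     pmf (map_pmf (\<lambda>s'. (s', dra_delta A q (g_label G s'))) (g_trans G s ud ua))"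
proof
  fix y :: "'s \<times> 'q"
  obtain s' q' where y: "y = (s', q')" by force
  let ?f = "\<lambda>s'. (s', dra_delta A q (g_label G s'))"
  have "?f -` {y} = (if dra_delta A q (g_label G s') = q' then {s'} else {})"
    by (auto simp: y)
  then show "product_prob G A (s, q) ud ua y = pmf (map_pmf ?f (g_trans G s ud ua)) y"
    by (simp add: pmf_map product_prob_def y measure_pmf_single)
qed

lemma pmf_product_game:
  "pmf (g_trans (product_game G A) x ud ua) y = product_prob G A x ud ua y"
  by (cases x) (simp add: product_game_def product_prob_eq_pmf embed_pmf_pmf)


section \<open>Finite state controllers\<close>

text \<open>
  Internal states are natural numbers, so that controllers of all sizes have one type.
  The values of \<open>fsc_step\<close> outside \<open>fsc_states\<close> are irrelevant.
\<close>

record ('ob, 'u) fsc =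
  fsc_states :: "nat set"
  fsc_init :: nat
  fsc_step :: "nat \<Rightarrow> 'ob \<Rightarrow> (nat \<times> 'u) pmf"

definition FSC :: "('ob, 'u) fsc set" where
  "FSC = {C. finite (fsc_states C) \<and> fsc_init C \<in> fsc_states C \<and>
     (\<forall>g\<in>fsc_states C. \<forall>ob. set_pmf (fsc_step C g ob) \<subseteq> fsc_states C \<times> UNIV)}"

lemma FSC_nonempty: "FSC \<noteq> {}"
proof -
  have "\<lparr>fsc_states = {0}, fsc_init = 0, fsc_step = (\<lambda>_ _. return_pmf (0, undefined))\<rparr> \<in> FSC"
    by (simp add: FSC_def)
  then show ?thesis by blast
qed


section \<open>The global Markov chain\<close>

definition gmc_prob ::
    "('x, 'ud::finite, 'ua::finite, 'od::finite, 'oa::finite, 'm) game_scheme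
      \<Rightarrow> ('od, 'ud) fsc \<Rightarrow> ('oa, 'ua) fsc \<Rightarrow> 'x \<times> nat \<times> nat \<Rightarrow> 'x \<times> nat \<times> nat \<Rightarrow> real" where
  "gmc_prob G Cd Ca = (\<lambda>(x, gd, ga) (x', gd', ga').
     \<Sum>od\<in>UNIV. \<Sum>oa\<in>UNIV. \<Sum>ud\<in>UNIV. \<Sum>ua\<in>UNIV.
       pmf (g_obs_d G x) od * pmf (g_obs_a G x) oa *
       pmf (fsc_step Cd gd od) (gd', ud) * pmf (fsc_step Ca ga oa) (ga', ua) *
       pmf (g_trans G x ud ua) x')"

definition gmc_step ::
    "('x, 'ud::finite, 'ua::finite, 'od::finite, 'oa::finite, 'm) game_scheme
      \<Rightarrow> ('od, 'ud) fsc \<Rightarrow> ('oa, 'ua) fsc \<Rightarrow> 'x \<times> nat \<times> nat \<Rightarrow> ('x \<times> nat \<times> nat) pmf" where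
  "gmc_step G Cd Ca z = embed_pmf (gmc_prob G Cd Ca z)"

definition gmc_states :: "('od, 'ud) fsc \<Rightarrow> ('oa, 'ua) fsc \<Rightarrow> ('x \<times> nat \<times> nat) set" where
  "gmc_states Cd Ca = UNIV \<times> fsc_states Cd \<times> fsc_states Ca"

definition gmc_paths ::
    "('x, 'ud::finite, 'ua::finite, 'od::finite, 'oa::finite, 'm) game_scheme
      \<Rightarrow> ('od, 'ud) fsc \<Rightarrow> ('oa, 'ua) fsc \<Rightarrow> (nat \<Rightarrow> 'x \<times> nat \<times> nat) measure" where
  "gmc_paths G Cd Ca =
     path_measure (return_pmf (g_init G, fsc_init Cd, fsc_init Ca)) (gmc_step G Cd Ca)"

definition gmc_sat_prob ::
    "('x, 'ud::finite, 'ua::finite, 'od::finite, 'oa::finite) rabin_game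
      \<Rightarrow> ('od, 'ud) fsc \<Rightarrow> ('oa, 'ua) fsc \<Rightarrow> real" where
  "gmc_sat_prob G Cd Ca =
     measure (gmc_paths G Cd Ca) {\<omega>. rabin_accepting (g_pairs G) (\<lambda>n. fst (\<omega> n))}"


section \<open>Controlled execution of the product game\<close>

text \<open>
  A stage records everything that happens in one round: the game state and the internal states of
  the controllers, the observations, the actions taken and the next internal states.
\<close>

record ('x, 'ud, 'ua, 'od, 'oa) stage =
  st_state :: 'x
  st_gd :: nat
  st_ga :: nat
  st_od :: 'od
  st_oa :: 'oa
  st_ud :: 'ud
  st_ua :: 'ua
  st_gd_next :: nat
  st_ga_next :: nat

definition play_stage ::
    "('x, 'ud, 'ua, 'od, 'oa, 'm) game_scheme \<Rightarrow> ('od, 'ud) fsc \<Rightarrow> ('oa, 'ua) fsc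
      \<Rightarrow> 'x \<Rightarrow> nat \<Rightarrow> nat \<Rightarrow> ('x, 'ud, 'ua, 'od, 'oa) stage pmf" where
  "play_stage G Cd Ca x gd ga = do {
     od \<leftarrow> g_obs_d G x;
     oa \<leftarrow> g_obs_a G x;
     (gd', ud) \<leftarrow> fsc_step Cd gd od;
     (ga', ua) \<leftarrow> fsc_step Ca ga oa;
     return_pmf \<lparr> st_state = x, st_gd = gd, st_ga = ga, st_od = od, st_oa = oa,
       st_ud = ud, st_ua = ua, st_gd_next = gd', st_ga_next = ga' \<rparr> }"

definition next_stage ::
    "('x, 'ud, 'ua, 'od, 'oa, 'm) game_scheme \<Rightarrow> ('od, 'ud) fsc \<Rightarrow> ('oa, 'ua) fsc
      \<Rightarrow> ('x, 'ud, 'ua, 'od, 'oa) stage \<Rightarrow> ('x, 'ud, 'ua, 'od, 'oa) stage pmf" where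
  "next_stage G Cd Ca t = do {
     x' \<leftarrow> g_trans G (st_state t) (st_ud t) (st_ua t);
     play_stage G Cd Ca x' (st_gd_next t) (st_ga_next t) }"

definition executions ::
    "('x, 'ud, 'ua, 'od, 'oa, 'm) game_scheme \<Rightarrow> ('od, 'ud) fsc \<Rightarrow> ('oa, 'ua) fsc
      \<Rightarrow> (nat \<Rightarrow> ('x, 'ud, 'ua, 'od, 'oa) stage) measure" where
  "executions G Cd Ca =
     path_measure (play_stage G Cd Ca (g_init G) (fsc_init Cd) (fsc_init Ca)) (next_stage G Cd Ca)"

text \<open>
  The label of the initial state is not read: by the definition of the product, the
  \<open>n\<close>-th letter read by the automaton is the label of the \<open>(n + 1)\<close>-st game state.
\<close>

definition exec_sat_prob ::
    "('s, 'ud, 'ua, 'od, 'oa, 'ap) posg \<Rightarrow> ('q, 'ap) dra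
      \<Rightarrow> ('od, 'ud) fsc \<Rightarrow> ('oa, 'ua) fsc \<Rightarrow> real" where
  "exec_sat_prob G A Cd Ca =
     measure (executions (product_game G A) Cd Ca)
       {\<omega>. dra_run A (\<lambda>n. g_label G (fst (st_state (\<omega> (Suc n))))) (\<lambda>n. snd (st_state (\<omega> n))) \<and>
           rabin_accepting (dra_pairs A) (\<lambda>n. snd (st_state (\<omega> n)))}"


section \<open>Recurrence classes\<close>

definition accessible :: "('a \<Rightarrow> 'a pmf) \<Rightarrow> 'a \<Rightarrow> 'a \<Rightarrow> bool" where
  "accessible K x y \<longleftrightarrow> (\<exists>n. measure (path_measure (return_pmf x) K) {\<omega>. \<omega> n = y} > 0)"

definition communicate :: "('a \<Rightarrow> 'a pmf) \<Rightarrow> 'a \<Rightarrow> 'a \<Rightarrow> bool" where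
  "communicate K x y \<longleftrightarrow> accessible K x y \<and> accessible K y x"

definition recurrent :: "('a \<Rightarrow> 'a pmf) \<Rightarrow> 'a \<Rightarrow> bool" where
  "recurrent K x \<longleftrightarrow> measure (path_measure (return_pmf x) K) {\<omega>. \<exists>n>0. \<omega> n = x} = 1"

definition recurrence_classes :: "'a set \<Rightarrow> ('a \<Rightarrow> 'a pmf) \<Rightarrow> 'a set set" where
  "recurrence_classes S K =
     {x\<in>S. recurrent K x} //
     {(x, y). x \<in> S \<and> y \<in> S \<and> recurrent K x \<and> recurrent K y \<and> communicate K x y}"

definition feasible :: "('x, 'ud, 'ua, 'od, 'oa) rabin_game \<Rightarrow> ('x \<times> nat \<times> nat) set \<Rightarrow> bool" where
  "feasible G R \<longleftrightarrow> (\<exists>(L, K)\<in>g_pairs G. K \<inter> fst ` R \<noteq> {} \<and> L \<inter> fst ` R = {})"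

definition rec_sets ::
    "('x, 'ud::finite, 'ua::finite, 'od::finite, 'oa::finite) rabin_game
      \<Rightarrow> ('od, 'ud) fsc \<Rightarrow> ('oa, 'ua) fsc \<Rightarrow> ('x \<times> nat \<times> nat) set set" where
  "rec_sets G Cd Ca =
     {R \<in> recurrence_classes (gmc_states Cd Ca) (gmc_step G Cd Ca). feasible G R}"

definition reach_prob ::
    "('x, 'ud::finite, 'ua::finite, 'od::finite, 'oa::finite) rabin_game
      \<Rightarrow> ('od, 'ud) fsc \<Rightarrow> ('oa, 'ua) fsc \<Rightarrow> ('x \<times> nat \<times> nat) set \<Rightarrow> real" where
  "reach_prob G Cd Ca R = measure (gmc_paths G Cd Ca) {\<omega>. \<exists>n. \<omega> n \<in> R}"


section \<open>Well-definedness\<close>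

lemma pmf_bind_finite:
  fixes p :: "'u::finite pmf"
  shows "pmf (bind_pmf p f) y = (\<Sum>u\<in>UNIV. pmf (f u) y * pmf p u)"
  unfolding pmf_bind by (rule integral_measure_pmf_real) auto

lemma pmf_bind_slice:
  fixes p :: "('g \<times> 'u::finite) pmf"
  assumes "\<And>g' u. g' \<noteq> g \<Longrightarrow> pmf (f (g', u)) y = 0"
  shows "pmf (bind_pmf p f) y = (\<Sum>u\<in>UNIV. pmf (f (g, u)) y * pmf p (g, u))"
proof -
  have "pmf (bind_pmf p f) y = (\<Sum>a\<in>Pair g ` UNIV. pmf (f a) y * pmf p a)"
    unfolding pmf_bind by (rule integral_measure_pmf_real) (use assms in auto)
  also have "\<dots> = (\<Sum>u\<in>UNIV. pmf (f (g, u)) y * pmf p (g, u))"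
    by (subst sum.reindex) (auto simp: inj_on_def)
  finally show ?thesis .
qed

lemma gmc_prob_eq_pmf:
  fixes G :: "('x, 'ud::finite, 'ua::finite, 'od::finite, 'oa::finite, 'm) game_scheme"
  shows "gmc_prob G Cd Ca (x, gd, ga) =
    pmf (bind_pmf (play_stage G Cd Ca x gd ga) (\<lambda>t.
      map_pmf (\<lambda>x'. (x', st_gd_next t, st_ga_next t)) (g_trans G x (st_ud t) (st_ua t))))"
proof
  fix y :: "'x \<times> nat \<times> nat"
  obtain x' gd' ga' where y: "y = (x', gd', ga')" by (cases y)
  have 1: "pmf (map_pmf (\<lambda>x'. (x', gd1, ga1)) T) y = (if gd1 = gd' \<and> ga1 = ga' then pmf T x' else 0)"
    for gd1 ga1 and T :: "'x pmf"
  proof -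
    have "(\<lambda>x'. (x', gd1, ga1)) -` {y} = (if gd1 = gd' \<and> ga1 = ga' then {x'} else {})"
      by (auto simp: y)
    then show ?thesis
      by (simp add: pmf_map measure_pmf_single)
  qed
  define h :: "'ud \<Rightarrow> 'ua \<Rightarrow> nat \<Rightarrow> nat \<Rightarrow> ('x \<times> nat \<times> nat) pmf"
    where "h ud ua gd1 ga1 = map_pmf (\<lambda>x'. (x', gd1, ga1)) (g_trans G x ud ua)" for ud ua gd1 ga1
  have a: "pmf (bind_pmf (fsc_step Ca ga oa) (\<lambda>(ga1, ua). h ud ua gd1 ga1)) y =
      (if gd1 = gd' then \<Sum>ua\<in>UNIV. pmf (g_trans G x ud ua) x' * pmf (fsc_step Ca ga oa) (ga', ua) else 0)"
    for oa ud gd1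
    by (subst pmf_bind_slice[where g = ga']) (auto simp: h_def 1)
  have d: "pmf (bind_pmf (fsc_step Cd gd od) (\<lambda>(gd1, ud).
        bind_pmf (fsc_step Ca ga oa) (\<lambda>(ga1, ua). h ud ua gd1 ga1))) y =
      (\<Sum>ud\<in>UNIV. (\<Sum>ua\<in>UNIV. pmf (g_trans G x ud ua) x' * pmf (fsc_step Ca ga oa) (ga', ua)) *
        pmf (fsc_step Cd gd od) (gd', ud))" for od oa
    by (subst pmf_bind_slice[where g = gd']) (auto simp: a)
  have "bind_pmf (play_stage G Cd Ca x gd ga) (\<lambda>t.
      map_pmf (\<lambda>x'. (x', st_gd_next t, st_ga_next t)) (g_trans G x (st_ud t) (st_ua t))) =
    bind_pmf (g_obs_d G x) (\<lambda>od. bind_pmf (g_obs_a G x) (\<lambda>oa.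
      bind_pmf (fsc_step Cd gd od) (\<lambda>(gd1, ud).
        bind_pmf (fsc_step Ca ga oa) (\<lambda>(ga1, ua). h ud ua gd1 ga1))))"
    by (simp add: play_stage_def bind_assoc_pmf bind_return_pmf case_prod_unfold h_def)
  then show "gmc_prob G Cd Ca (x, gd, ga) y = pmf (bind_pmf (play_stage G Cd Ca x gd ga) (\<lambda>t.
      map_pmf (\<lambda>x'. (x', st_gd_next t, st_ga_next t)) (g_trans G x (st_ud t) (st_ua t)))) y"
    by (simp add: pmf_bind_finite d[unfolded y] y gmc_prob_def sum_distrib_left sum_distrib_right mult_ac)
qed

lemma pmf_gmc_step:
  fixes G :: "('x, 'ud::finite, 'ua::finite, 'od::finite, 'oa::finite, 'm) game_scheme"
  shows "pmf (gmc_step G Cd Ca z) z' = gmc_prob G Cd Ca z z'"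
  by (cases z) (simp add: gmc_step_def gmc_prob_eq_pmf embed_pmf_pmf)

lemma finite_rec_sets:
  fixes G :: "('x::finite, 'ud::finite, 'ua::finite, 'od::finite, 'oa::finite) rabin_game"
  assumes "Cd \<in> FSC" "Ca \<in> FSC"
  shows "finite (rec_sets G Cd Ca)"
proof -
  have "finite (gmc_states Cd Ca :: ('x \<times> nat \<times> nat) set)"
    using assms by (simp add: FSC_def gmc_states_def)
  moreover have "rec_sets G Cd Ca \<subseteq> Pow (gmc_states Cd Ca)"
    by (auto simp: rec_sets_def recurrence_classes_def quotient_def)
  ultimately show ?thesis
    by (meson finite_Pow_iff finite_subset)
qed

end

(* On a finite chain, if y is accessible from x, then almost every path that visits x infinitely
   often visits y infinitely often. Hence the set of states that a path visits infinitely often is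
   almost surely closed under accessibility, so that it is a recurrence class, and it is the only
   recurrence class that the path reaches. A path is accepting iff this class is feasible, and
   summing over the feasible classes gives the reachability formula. The controlled execution
   refines the global Markov chain: forgetting observations and actions turns the law of one into
   the law of the other. *)

theory Submission
  imports Defs
begin

section \<open>Paths of a Markov chain with countably many states\<close>

text \<open>The second and third quantities agree with the first for each pair of controllers, so
  the game-theoretic extrema enter only through congruence. Internal states are natural numbers, so
  the type of global states is infinite. The path arguments therefore work over countable state
  types, and finiteness comes from the closed set \<open>gmc_states\<close>, which almost every path
  never leaves. Countability is used twice: an event decided by finitely many coordinates splits
  into countably many prefixes, and an almost-sure claim proved for one state and one time extends
  to all states and times at once. Since recurrence is defined by a return probability equal to 1,
  no expected numbers of visits appear. The theory is read off typical paths: a claim about states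
  that holds almost surely, but does not mention the path, is true because some path witnesses it.
  Reachability events of distinct classes are disjoint only up to null sets, which is why the sum is
  formed with the events that fix the limit set.\<close>

lemma measurable_path_coord [measurable]:
  "(\<lambda>\<omega>. \<omega> n) \<in> measurable (PiM UNIV (\<lambda>_. count_space UNIV)) (count_space (UNIV :: 'a set))"
  by (rule measurable_component_singleton) simp

lemma measurable_path_shift:
  "(\<lambda>\<omega> i. \<omega> (n + i)) \<in> measurable (PiM UNIV (\<lambda>_. count_space UNIV)) (PiM UNIV (\<lambda>_. count_space (UNIV :: 'a set)))"
proof (rule measurable_PiM_single')
  show "(\<lambda>\<omega> i. \<omega> (n + i)) \<in> space (PiM UNIV (\<lambda>_. count_space UNIV)) \<rightarrow> (UNIV \<rightarrow>\<^sub>E space (count_space (UNIV :: 'a set)))"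
    by (simp only: space_PiM space_count_space PiE_UNIV) auto
qed (rule measurable_path_coord)

lemma pred_path_shift:
  assumes "Measurable.pred (PiM UNIV (\<lambda>_. count_space (UNIV :: 'a set))) B"
  shows "Measurable.pred (PiM UNIV (\<lambda>_. count_space UNIV)) (\<lambda>\<omega>. B (\<lambda>i. \<omega> (n + i)))"
  by (rule measurable_compose[OF measurable_path_shift assms])

lemma pred_path_coord:
  "Measurable.pred (PiM UNIV (\<lambda>_. count_space (UNIV :: 'a set))) (\<lambda>\<omega>. Q (\<omega> n))"
  by (rule measurable_compose[where f = "\<lambda>\<omega>. \<omega> n" and g = Q, OF measurable_path_coord measurable_count_space])

lemma prefix_eq_iff:
  "map \<omega> [0..<n] = l \<longleftrightarrow> length l = n \<and> (\<forall>i<n. \<omega> i = l ! i)"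
  unfolding list_eq_iff_nth_eq by (simp cong: conj_cong) metis

text \<open>There are only countably many words over a countable alphabet, so it suffices that the
  preimage of each single word is measurable, and such a preimage is a cylinder or empty.\<close>

lemma pred_path_prefix:
  "Measurable.pred (PiM UNIV (\<lambda>_. count_space (UNIV :: 'a::countable set))) (\<lambda>\<omega>. Q (map \<omega> [0..<n]))"
proof -
  have "(\<lambda>\<omega>. map \<omega> [0..<n]) \<in> measurable (PiM UNIV (\<lambda>_. count_space (UNIV :: 'a set))) (count_space UNIV)"
  proof (rule measurable_count_space_eq2_countable[THEN iffD2], intro conjI ballI)
    fix l :: "'a list"
    have "(\<lambda>\<omega>. map \<omega> [0..<n]) -` {l} = {\<omega>. length l = n \<and> (\<forall>i<n. \<omega> i = l ! i)}"
      by (simp only: vimage_def prefix_eq_iff singleton_iff)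
    also have "\<dots> = {\<omega>\<in>space (PiM UNIV (\<lambda>_. count_space (UNIV :: 'a set))). length l = n \<and> (\<forall>i<n. \<omega> i = l ! i)}"
      by (simp add: space_PiM)
    also have "\<dots> \<in> sets (PiM UNIV (\<lambda>_. count_space (UNIV :: 'a set)))"
      by measurable
    finally show "(\<lambda>\<omega>. map \<omega> [0..<n]) -` {l} \<inter> space (PiM UNIV (\<lambda>_. count_space (UNIV :: 'a set)))
        \<in> sets (PiM UNIV (\<lambda>_. count_space (UNIV :: 'a set)))"
      by (simp add: space_PiM)
  qed auto
  then show ?thesis
    by (rule measurable_compose[where f = "\<lambda>\<omega>. map \<omega> [0..<n]" and g = Q, OF _ measurable_count_space])
qed

text \<open>Such an event factors through the prefix of length \<open>Suc n\<close>. The path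
  \<open>\<lambda>i. l ! i\<close> has unspecified values beyond that prefix, and the assumption
  makes them irrelevant.\<close>

lemma pred_path_adapted:
  fixes A :: "(nat \<Rightarrow> 'a::countable) \<Rightarrow> bool"
  assumes "\<And>\<omega> \<omega>'. (\<And>i. i \<le> n \<Longrightarrow> \<omega> i = \<omega>' i) \<Longrightarrow> A \<omega> \<longleftrightarrow> A \<omega>'"
  shows "Measurable.pred (PiM UNIV (\<lambda>_. count_space UNIV)) A"
proof -
  have "(\<lambda>\<omega>. (\<lambda>l. A (\<lambda>i. l ! i)) (map \<omega> [0..<Suc n])) = A"
    by (intro ext assms) (simp add: less_Suc_eq_le del: upt_Suc)
  with pred_path_prefix[of "\<lambda>l. A (\<lambda>i. l ! i)" "Suc n"] show ?thesis
    by (simp only:)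
qed

text \<open>Countable additivity over words, with the sum written as an integral over a counting
  measure so that no summability has to be shown. Words of the wrong length contribute the empty
  event.\<close>

lemma emeasure_sum_prefixes:
  fixes M :: "(nat \<Rightarrow> 'a::countable) measure"
  assumes [measurable_cong]: "sets M = sets (PiM UNIV (\<lambda>_. count_space UNIV))"
    and [measurable]: "Measurable.pred (PiM UNIV (\<lambda>_. count_space UNIV)) B"
  shows "emeasure M {\<omega>. Q (map \<omega> [0..<n]) \<and> B \<omega>} =
    (\<integral>\<^sup>+l. emeasure M {\<omega>. map \<omega> [0..<n] = l \<and> B \<omega>} \<partial>count_space {l. Q l})"
proof -
  have sp: "space M = UNIV"
    using sets_eq_imp_space_eq[OF assms(1)] by (simp add: space_PiM)
  have "{\<omega>\<in>space M. map \<omega> [0..<n] = l \<and> B \<omega>} \<in> sets M" for l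
  proof -
    have [measurable]: "Measurable.pred (PiM UNIV (\<lambda>_. count_space UNIV)) (\<lambda>\<omega>. map \<omega> [0..<n] = l)"
      by (rule pred_path_prefix)
    have "Measurable.pred M (\<lambda>\<omega>. map \<omega> [0..<n] = l \<and> B \<omega>)"
      unfolding measurable_cong_sets[OF assms(1) refl] by (intro pred_intros_logic) fact+
    then show ?thesis by (simp add: pred_def)
  qed
  then have "emeasure M (\<Union>l\<in>{l. Q l}. {\<omega>. map \<omega> [0..<n] = l \<and> B \<omega>}) =
    (\<integral>\<^sup>+l. emeasure M {\<omega>. map \<omega> [0..<n] = l \<and> B \<omega>} \<partial>count_space {l. Q l})"
    by (intro emeasure_UN_countable) (auto simp: disjoint_family_on_def sp)
  also have "(\<Union>l\<in>{l. Q l}. {\<omega>. map \<omega> [0..<n] = l \<and> B \<omega>}) = {\<omega>. Q (map \<omega> [0..<n]) \<and> B \<omega>}"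
    by auto
  finally show ?thesis .
qed

text \<open>The product sigma-algebra is generated by boxes with arbitrary sides in finitely many
  coordinates. Over a countable state space each box is a countable disjoint union of prefix events,
  so agreement on single prefixes is enough.\<close>

lemma measure_eqI_cylinders:
  fixes M N :: "(nat \<Rightarrow> 'a::countable) measure"
  assumes M: "sets M = sets (PiM UNIV (\<lambda>_. count_space UNIV))"
    and N: "sets N = sets (PiM UNIV (\<lambda>_. count_space UNIV))"
    and fin: "finite_measure M"
    and eq: "\<And>n x. emeasure M {\<omega>. \<forall>i\<le>n. \<omega> i = x i} = emeasure N {\<omega>. \<forall>i\<le>n. \<omega> i = x i}"
  shows "M = N"
proof (rule measure_eqI_PiM_infinite[OF M N _ fin])
  fix J :: "nat set" and A :: "nat \<Rightarrow> 'a set"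
  assume J: "finite J"
  obtain n where n: "\<And>i. i \<in> J \<Longrightarrow> i \<le> n"
    using finite_nat_set_iff_bounded_le[of J] J by auto
  let ?Q = "\<lambda>l. \<forall>j\<in>J. l ! j \<in> A j"
  have *: "prod_emb UNIV (\<lambda>_. count_space UNIV) J (Pi\<^sub>E J A) = {\<omega>. ?Q (map \<omega> [0..<Suc n]) \<and> True}"
    using n by (auto simp: prod_emb_def PiE_iff less_Suc_eq_le simp del: upt_Suc)
  have **: "emeasure M {\<omega>. map \<omega> [0..<Suc n] = l} = emeasure N {\<omega>. map \<omega> [0..<Suc n] = l}" for l
    using eq[of n "\<lambda>i. l ! i"] by (cases "length l = Suc n") (simp_all add: prefix_eq_iff less_Suc_eq_le del: upt_Suc)
  show "emeasure M (prod_emb UNIV (\<lambda>_. count_space UNIV) J (Pi\<^sub>E J A)) =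
      emeasure N (prod_emb UNIV (\<lambda>_. count_space UNIV) J (Pi\<^sub>E J A))"
    unfolding * by (subst (1 2) emeasure_sum_prefixes) (use M N in \<open>simp_all add: ** del: upt_Suc\<close>)
qed

section \<open>The Markov property\<close>

lemma emeasure_path_cylinder:
  "emeasure (path_measure p K) {\<omega>. \<forall>i\<le>n. \<omega> i = x i} =
     ennreal (pmf p (x 0) * (\<Prod>i<n. pmf (K (x i)) (x (Suc i))))"
proof -
  interpret prob_space "path_measure p K" by (rule prob_space_path_measure)
  show ?thesis by (simp add: emeasure_eq_measure path_measure_cylinder)
qed

text \<open>For a fixed prefix \<open>x\<close>, both sides are finite measures of the event
  \<open>B\<close>. They agree on cylinders because the product of transition probabilities splits
  at time \<open>n\<close>, hence they agree everywhere.\<close>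

lemma emeasure_path_prefix_shift:
  fixes K :: "'a::countable \<Rightarrow> 'a pmf"
  assumes B[measurable]: "Measurable.pred (PiM UNIV (\<lambda>_. count_space UNIV)) B"
  shows "emeasure (path_measure p K) {\<omega>. (\<forall>i\<le>n. \<omega> i = x i) \<and> B (\<lambda>i. \<omega> (n + i))} =
    emeasure (path_measure p K) {\<omega>. \<forall>i\<le>n. \<omega> i = x i} *
    emeasure (path_measure (return_pmf (x n)) K) {\<omega>. B \<omega>}"
proof -
  let ?\<Pi> = "PiM UNIV (\<lambda>_. count_space (UNIV :: 'a set)) :: (nat \<Rightarrow> 'a) measure"
  let ?M = "path_measure p K" and ?P = "path_measure (return_pmf (x n)) K"
  interpret M: prob_space ?M by (rule prob_space_path_measure)
  interpret P: prob_space ?P by (rule prob_space_path_measure)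
  define c where "c = emeasure ?M {\<omega>. \<forall>i\<le>n. \<omega> i = x i}"
  let ?C = "{\<omega>. \<forall>i\<le>n. \<omega> i = x i}"
  \<comment> \<open>The left side as a measure in \<open>B\<close>: restrict to the prefix event,
    then forget the first \<open>n\<close> coordinates. \<open>?N2\<close> is the right
    side.\<close>
  let ?N1 = "distr (density ?M (indicator ?C)) ?\<Pi> (\<lambda>\<omega> i. \<omega> (n + i))"
  let ?N2 = "density ?P (\<lambda>_. c)"
  have C: "?C \<in> sets ?M"
  proof -
    have "{\<omega>\<in>space ?M. \<forall>i\<le>n. \<omega> i = x i} \<in> sets ?M" by measurable
    then show ?thesis by simp
  qed
  have N1: "emeasure ?N1 {\<omega>. B \<omega>} = emeasure ?M {\<omega>. (\<forall>i\<le>n. \<omega> i = x i) \<and> B (\<lambda>i. \<omega> (n + i))}"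
    if [measurable]: "Measurable.pred ?\<Pi> B" for B
  proof -
    have sB: "{\<omega>. B \<omega>} \<in> sets ?\<Pi>"
      using that by (simp add: pred_def space_PiM)
    have sB': "{\<omega>. B (\<lambda>i. \<omega> (n + i))} \<in> sets ?M"
    proof -
      show ?thesis using pred_path_shift[OF that]
        by (simp add: pred_def space_PiM sets_path_measure)
    qed
    have "emeasure ?N1 {\<omega>. B \<omega>} = emeasure (density ?M (indicator ?C)) {\<omega>. B (\<lambda>i. \<omega> (n + i))}"
      by (subst emeasure_distr[OF _ sB])
        (simp_all add: vimage_def measurable_path_shift measurable_cong_sets[OF sets_path_measure refl])
    also have "\<dots> = (\<integral>\<^sup>+\<omega>. indicator ?C \<omega> * indicator {\<omega>. B (\<lambda>i. \<omega> (n + i))} \<omega> \<partial>?M)"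
      using C sB' by (subst emeasure_density) auto
    also have "\<dots> = (\<integral>\<^sup>+\<omega>. indicator (?C \<inter> {\<omega>. B (\<lambda>i. \<omega> (n + i))}) \<omega> \<partial>?M)"
      by (simp add: indicator_inter_arith)
    also have "\<dots> = emeasure ?M (?C \<inter> {\<omega>. B (\<lambda>i. \<omega> (n + i))})"
      using C sB' by (subst nn_integral_indicator) auto
    finally show ?thesis by (simp add: Collect_conj_eq)
  qed
  have N2: "emeasure ?N2 {\<omega>. B \<omega>} = c * emeasure ?P {\<omega>. B \<omega>}"
    if "Measurable.pred ?\<Pi> B" for B
    using that by (subst emeasure_density_const) (auto simp: pred_def space_PiM sets_path_measure)
  have "?N1 = ?N2"
  proof (rule measure_eqI_cylinders)
    show "finite_measure ?N1"
    proof
      have "emeasure ?N1 {\<omega>. True} \<noteq> \<infinity>"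
        by (subst N1) (auto simp: M.emeasure_eq_measure)
      then show "emeasure ?N1 (space ?N1) \<noteq> \<infinity>" by (simp add: space_PiM)
    qed
    fix m :: nat and y :: "nat \<Rightarrow> 'a"
    have "emeasure ?M {\<omega>. (\<forall>i\<le>n. \<omega> i = x i) \<and> (\<forall>i\<le>m. \<omega> (n + i) = y i)} =
        c * emeasure ?P {\<omega>. \<forall>i\<le>m. \<omega> i = y i}"
    \<comment> \<open>Coordinate \<open>n\<close> is prescribed twice, by \<open>x n\<close> and by
      \<open>y 0\<close>. If these differ, both sides vanish.\<close>
    proof (cases "y 0 = x n")
      case False
      then have "{\<omega>. (\<forall>i\<le>n. \<omega> i = x i) \<and> (\<forall>i\<le>m. \<omega> (n + i) = y i)} = {}"
        by (auto dest!: spec[of _ 0] spec[of _ n])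
      then show ?thesis using False by (simp only: emeasure_path_cylinder pmf_return) simp
    next
      case True
      \<comment> \<open>The two words glued along their common letter at position \<open>n\<close>;
        the overlap makes \<open>w (n + i) = y i\<close> hold at \<open>i = 0\<close> as
        well.\<close>
      define w where "w j = (if j \<le> n then x j else y (j - n))" for j
      have w: "w (n + i) = y i" for i
        using True by (auto simp: w_def)
      have "{\<omega>. (\<forall>i\<le>n. \<omega> i = x i) \<and> (\<forall>i\<le>m. \<omega> (n + i) = y i)} = {\<omega>. \<forall>i\<le>n+m. \<omega> i = w i}" (is "?X = ?Y")
      proof (intro equalityI subsetI)
        fix \<omega> assume *: "\<omega> \<in> ?X"
        have "\<omega> i = w i" if "i \<le> n + m" for i
        proof (cases "i \<le> n")
          case False
          then have "i = n + (i - n)" "i - n \<le> m" using that by auto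
          then show ?thesis using * False by (metis (mono_tags, lifting) mem_Collect_eq w)
        qed (use * in \<open>auto simp: w_def\<close>)
        then show "\<omega> \<in> ?Y" by simp
      next
        fix \<omega> assume *: "\<omega> \<in> ?Y"
        then have "\<omega> (n + i) = y i" if "i \<le> m" for i using that by (simp add: w)
        moreover have "\<omega> i = x i" if "i \<le> n" for i using * that by (simp add: w_def)
        ultimately show "\<omega> \<in> ?X" by simp
      qed
      moreover have "(\<Prod>i<n + m. pmf (K (w i)) (w (Suc i))) =
        (\<Prod>i<n. pmf (K (x i)) (x (Suc i))) * (\<Prod>i<m. pmf (K (y i)) (y (Suc i)))"
      proof -
        have "(\<Prod>i<n + m. g i) = (\<Prod>i<n. g i) * (\<Prod>i<m. g (n + i))" for g :: "nat \<Rightarrow> real"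
          by (induction m) (simp_all add: mult_ac)
        moreover have "w (Suc (n + i)) = y (Suc i)" for i using w[of "Suc i"] by simp
        ultimately show ?thesis by (simp add: w) (simp add: w_def)
      qed
      moreover have "w 0 = x 0" by (simp add: w_def)
      ultimately show ?thesis using True
        by (simp add: c_def emeasure_path_cylinder ennreal_mult[symmetric] prod_nonneg mult.assoc)
    qed
    then show "emeasure ?N1 {\<omega>. \<forall>i\<le>m. \<omega> i = y i} = emeasure ?N2 {\<omega>. \<forall>i\<le>m. \<omega> i = y i}"
      by (subst N1 N2; measurable?)+
  qed (simp_all add: sets_path_measure)
  then show ?thesis
    using N1[OF B] N2[OF B] by (simp add: c_def)
qed

text \<open>The condition on \<open>A\<close> says that it is decided by time \<open>n\<close>.
  Summing the fixed-prefix version over all prefixes that satisfy \<open>A\<close> and end in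
  \<open>z\<close> gives the claim, because the second factor depends on a prefix only through its
  last letter.\<close>

theorem path_markov:
  fixes K :: "'a::countable \<Rightarrow> 'a pmf"
  assumes A: "\<And>\<omega> \<omega>'. (\<And>i. i \<le> n \<Longrightarrow> \<omega> i = \<omega>' i) \<Longrightarrow> A \<omega> \<longleftrightarrow> A \<omega>'"
    and B[measurable]: "Measurable.pred (PiM UNIV (\<lambda>_. count_space UNIV)) B"
  shows "measure (path_measure p K) {\<omega>. A \<omega> \<and> \<omega> n = z \<and> B (\<lambda>i. \<omega> (n + i))} =
    measure (path_measure p K) {\<omega>. A \<omega> \<and> \<omega> n = z} *
    measure (path_measure (return_pmf z) K) {\<omega>. B \<omega>}"
proof -
  let ?M = "path_measure p K" and ?P = "path_measure (return_pmf z) K"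
  define Q where "Q l \<longleftrightarrow> length l = Suc n \<and> A (\<lambda>i. l ! i) \<and> l ! n = z" for l :: "'a list"
  have Q: "Q (map \<omega> [0..<Suc n]) \<longleftrightarrow> A \<omega> \<and> \<omega> n = z" for \<omega>
  proof -
    have "A (\<lambda>i. map \<omega> [0..<Suc n] ! i) \<longleftrightarrow> A \<omega>"
      by (intro A) (simp add: less_Suc_eq_le del: upt_Suc)
    moreover have "map \<omega> [0..<Suc n] ! n = \<omega> n" by (simp del: upt_Suc)
    ultimately show ?thesis by (simp add: Q_def del: upt_Suc)
  qed
  have pre: "emeasure ?M {\<omega>. map \<omega> [0..<Suc n] = l \<and> B (\<lambda>i. \<omega> (n + i))} =
      emeasure ?M {\<omega>. map \<omega> [0..<Suc n] = l \<and> True} * emeasure ?P {\<omega>. B \<omega>}" if "Q l" for l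
    using that emeasure_path_prefix_shift[OF B, of p K n "\<lambda>i. l ! i"]
    by (simp add: prefix_eq_iff less_Suc_eq_le Q_def del: upt_Suc)
  have "emeasure ?M {\<omega>. Q (map \<omega> [0..<Suc n]) \<and> B (\<lambda>i. \<omega> (n + i))} =
      emeasure ?M {\<omega>. Q (map \<omega> [0..<Suc n]) \<and> True} * emeasure ?P {\<omega>. B \<omega>}"
    by (subst (1 2) emeasure_sum_prefixes)
      (auto simp: sets_path_measure pred_path_shift[OF B] pre nn_integral_multc[symmetric] simp del: upt_Suc intro!: nn_integral_cong)
  then show ?thesis
    by (simp add: Q measure_def enn2real_mult conj_assoc del: upt_Suc)
qed

section \<open>States visited infinitely often\<close>

lemma sets_Collect_path:
  "Measurable.pred (PiM UNIV (\<lambda>_. count_space UNIV)) Q \<Longrightarrow> {\<omega>. Q \<omega>} \<in> sets (path_measure p K)"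
  by (simp add: pred_def space_PiM sets_path_measure)

lemma AE_path_iff:
  assumes "Measurable.pred (PiM UNIV (\<lambda>_. count_space UNIV)) Q"
  shows "(AE \<omega> in path_measure p K. Q \<omega>) \<longleftrightarrow> measure (path_measure p K) {\<omega>. \<not> Q \<omega>} = 0"
proof -
  interpret prob_space "path_measure p K" by (rule prob_space_path_measure)
  have "{\<omega>. \<not> Q \<omega>} \<in> sets (path_measure p K)"
    by (intro sets_Collect_path pred_intros_logic assms)
  then show ?thesis
    by (subst AE_iff_measurable[OF _ refl]) (simp_all add: emeasure_eq_measure)
qed

lemma AE_path_eq_1:
  assumes "Measurable.pred (PiM UNIV (\<lambda>_. count_space UNIV)) Q"
  shows "(AE \<omega> in path_measure p K. Q \<omega>) \<longleftrightarrow> measure (path_measure p K) {\<omega>. Q \<omega>} = 1"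
proof -
  interpret prob_space "path_measure p K" by (rule prob_space_path_measure)
  show ?thesis
    by (subst prob_eq_1) (simp_all add: sets_Collect_path assms)
qed

text \<open>The Markov property for the complement of \<open>B\<close>: a product of two
  probabilities is zero iff one factor is. From right to left it transports almost-sure facts to
  time \<open>n\<close> of any chain; from left to right it extracts facts about a state that is hit
  with positive probability.\<close>

lemma AE_path_shift_iff:
  fixes K :: "'a::countable \<Rightarrow> 'a pmf"
  assumes B: "Measurable.pred (PiM UNIV (\<lambda>_. count_space UNIV)) B"
  shows "(AE \<omega> in path_measure p K. \<omega> n = z \<longrightarrow> B (\<lambda>i. \<omega> (n + i))) \<longleftrightarrow>
    measure (path_measure p K) {\<omega>. \<omega> n = z} = 0 \<or> (AE \<omega> in path_measure (return_pmf z) K. B \<omega>)"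
proof -
  have "Measurable.pred (PiM UNIV (\<lambda>_. count_space UNIV)) (\<lambda>\<omega>. \<omega> n = z \<longrightarrow> B (\<lambda>i. \<omega> (n + i)))"
    by (intro pred_intros_logic pred_path_coord pred_path_shift B)
  moreover have "measure (path_measure p K) {\<omega>. \<omega> n = z \<and> \<not> B (\<lambda>i. \<omega> (n + i))} =
    measure (path_measure p K) {\<omega>. \<omega> n = z} *
    measure (path_measure (return_pmf z) K) {\<omega>. \<not> B \<omega>}"
    using path_markov[of n "\<lambda>_. True" "\<lambda>\<omega>. \<not> B \<omega>" p K z] B by simp
  ultimately show ?thesis
    by (simp add: AE_path_iff B)
qed

lemma AE_path_0: "AE \<omega> in path_measure p (K :: 'a::countable \<Rightarrow> 'a pmf). \<omega> 0 \<in> set_pmf p"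
proof -
  have "AE \<omega> in path_measure p K. \<omega> 0 = b \<longrightarrow> b \<in> set_pmf p" for b
  proof (cases "b \<in> set_pmf p")
    case False
    have "measure (path_measure p K) {\<omega>. \<omega> 0 = b} = 0"
      using path_measure_cylinder[of p K 0 "\<lambda>_. b"] False by (simp add: set_pmf_iff)
    then show ?thesis using False by (simp add: AE_path_iff pred_path_coord)
  qed simp
  then have "AE \<omega> in path_measure p K. \<forall>b. \<omega> 0 = b \<longrightarrow> b \<in> set_pmf p"
    unfolding AE_all_countable by blast
  then show ?thesis by simp
qed

lemma AE_path_return_0: "AE \<omega> in path_measure (return_pmf x) (K :: 'a::countable \<Rightarrow> 'a pmf). \<omega> 0 = x"
  using AE_path_0[of "return_pmf x" K] by simp

lemma AE_path_step:
  "AE \<omega> in path_measure p (K :: 'a::countable \<Rightarrow> 'a pmf). \<forall>n. \<omega> (Suc n) \<in> set_pmf (K (\<omega> n))"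
proof -
  have *: "AE \<omega> in path_measure (return_pmf z) K. \<omega> 1 \<in> set_pmf (K z)" for z
  proof -
    \<comment> \<open>Each forbidden transition is excluded on its own; there are countably many
      targets \<open>b\<close>.\<close>
    have "AE \<omega> in path_measure (return_pmf z) K. b \<notin> set_pmf (K z) \<longrightarrow> \<not> (\<omega> 0 = z \<and> \<omega> 1 = b)" for b
    proof (rule AE_impI)
      assume "b \<notin> set_pmf (K z)"
      have "{\<omega>. \<forall>i\<le>1::nat. \<omega> i = (if i = 0 then z else b)} = {\<omega>. \<omega> 0 = z \<and> \<omega> 1 = b}"
        by (auto simp: le_Suc_eq all_conj_distrib)
      with path_measure_cylinder[of "return_pmf z" K 1 "\<lambda>i. if i = 0 then z else b"] \<open>b \<notin> set_pmf (K z)\<close>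
      have "measure (path_measure (return_pmf z) K) {\<omega>. \<omega> 0 = z \<and> \<omega> 1 = b} = 0"
        by (simp add: set_pmf_iff)
      moreover have "Measurable.pred (PiM UNIV (\<lambda>_. count_space UNIV)) (\<lambda>\<omega>. \<not> (\<omega> 0 = z \<and> \<omega> 1 = b))"
        by (intro pred_intros_logic pred_path_coord)
      ultimately show "AE \<omega> in path_measure (return_pmf z) K. \<not> (\<omega> 0 = z \<and> \<omega> 1 = b)"
        by (subst AE_path_iff) simp_all
    qed
    then have "AE \<omega> in path_measure (return_pmf z) K. \<forall>b. b \<notin> set_pmf (K z) \<longrightarrow> \<not> (\<omega> 0 = z \<and> \<omega> 1 = b)"
      unfolding AE_all_countable by blast
    with AE_path_return_0[of z K] show ?thesis by eventually_elim auto
  qed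
  have "AE \<omega> in path_measure p K. \<omega> n = z \<longrightarrow> \<omega> (n + 1) \<in> set_pmf (K z)" for n z
    by (rule AE_path_shift_iff[THEN iffD2]) (auto intro: pred_path_coord simp: *[simplified])
  then have "AE \<omega> in path_measure p K. \<forall>n z. \<omega> n = z \<longrightarrow> \<omega> (n + 1) \<in> set_pmf (K z)"
    unfolding AE_all_countable by blast
  then show ?thesis by simp
qed

lemma AE_path_invariant:
  fixes K :: "'a::countable \<Rightarrow> 'a pmf"
  assumes "set_pmf p \<subseteq> S" "\<And>x. x \<in> S \<Longrightarrow> set_pmf (K x) \<subseteq> S"
  shows "AE \<omega> in path_measure p K. \<forall>n. \<omega> n \<in> S"
  using AE_path_0 AE_path_step
proof eventually_elim
  case (elim \<omega>)
  show ?case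
  proof
    fix n show "\<omega> n \<in> S" using elim assms by (induction n) auto
  qed
qed

text \<open>The empty set is not of full measure. Applied to a \<open>Q\<close> that ignores the
  path, this turns an almost-sure statement into a plain fact.\<close>

lemma ex_path_of_AE:
  assumes "AE \<omega> in path_measure p K. Q \<omega>" shows "\<exists>\<omega>. Q \<omega>"
proof -
  interpret prob_space "path_measure p K" by (rule prob_space_path_measure)
  show ?thesis using eventually_happens'[OF ae_filter_bot assms] .
qed

section \<open>Accessibility\<close>

lemma accessible_iff_not_AE:
  "accessible K x y \<longleftrightarrow> (\<exists>n. \<not> (AE \<omega> in path_measure (return_pmf x) K. \<omega> n \<noteq> y))"
  unfolding accessible_def
  by (subst AE_path_iff) (auto intro!: pred_intros_logic pred_path_coord simp: zero_less_measure_iff)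

lemma accessible_trans:
  fixes K :: "'a::countable \<Rightarrow> 'a pmf"
  assumes "accessible K x y" "accessible K y z"
  shows "accessible K x z"
proof -
  obtain n m where *: "measure (path_measure (return_pmf x) K) {\<omega>. \<omega> n = y} > 0"
     "measure (path_measure (return_pmf y) K) {\<omega>. \<omega> m = z} > 0"
    using assms by (auto simp: accessible_def)
  interpret prob_space "path_measure (return_pmf x) K" by (rule prob_space_path_measure)
  have "measure (path_measure (return_pmf x) K) {\<omega>. \<omega> n = y \<and> \<omega> (n + m) = z} > 0"
    using path_markov[of n "\<lambda>_. True" "\<lambda>\<omega>. \<omega> m = z" "return_pmf x" K y] * by (simp add: pred_path_coord)
  also have "measure (path_measure (return_pmf x) K) {\<omega>. \<omega> n = y \<and> \<omega> (n + m) = z} \<le>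
      measure (path_measure (return_pmf x) K) {\<omega>. \<omega> (n + m) = z}"
    by (intro finite_measure_mono sets_Collect_path pred_path_coord) auto
  finally show ?thesis unfolding accessible_def by blast
qed

lemma AE_path_accessible:
  "AE \<omega> in path_measure p (K :: 'a::countable \<Rightarrow> 'a pmf). \<forall>n i. accessible K (\<omega> n) (\<omega> (n + i))"
proof -
  have "AE \<omega> in path_measure (return_pmf z) K. accessible K z (\<omega> i)" for z i
  proof -
    have "AE \<omega> in path_measure (return_pmf z) K. \<omega> i = y \<longrightarrow> accessible K z y" for y
      by (cases "accessible K z y") (auto simp: accessible_iff_not_AE)
    then have "AE \<omega> in path_measure (return_pmf z) K. \<forall>y. \<omega> i = y \<longrightarrow> accessible K z y"
      unfolding AE_all_countable by blast
    then show ?thesis by simp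
  qed
  then have "AE \<omega> in path_measure p K. \<omega> n = z \<longrightarrow> accessible K z (\<omega> (n + i))" for n z i
    by (intro AE_path_shift_iff[THEN iffD2] disjI2) (auto intro: pred_path_coord)
  then have "AE \<omega> in path_measure p K. \<forall>n i z. \<omega> n = z \<longrightarrow> accessible K z (\<omega> (n + i))"
    unfolding AE_all_countable by blast
  then show ?thesis by simp
qed

text \<open>A substitute for the strong Markov property. Each index \<open>i\<close> is one way of
  stopping, at time \<open>n i\<close> in state \<open>z i\<close>, recognised by \<open>A i\<close>
  from the past; distinct ways exclude each other. It is applied with \<open>i\<close> the time of
  the first visit to a fixed state, and with \<open>i\<close> the state occupied at a fixed
  time.\<close>

lemma path_markov_le:
  fixes K :: "'a::countable \<Rightarrow> 'a pmf" and n :: "'i::countable \<Rightarrow> nat"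
  assumes A: "\<And>i \<omega> \<omega>'. (\<And>j. j \<le> n i \<Longrightarrow> \<omega> j = \<omega>' j) \<Longrightarrow> A i \<omega> \<longleftrightarrow> A i \<omega>'"
    and disj: "\<And>i j \<omega>. A i \<omega> \<Longrightarrow> A j \<omega> \<Longrightarrow> \<omega> (n i) = z i \<Longrightarrow> \<omega> (n j) = z j \<Longrightarrow> i = j"
    and B: "Measurable.pred (PiM UNIV (\<lambda>_. count_space UNIV)) B"
    and le: "\<And>i. measure (path_measure (return_pmf (z i)) K) {\<omega>. B \<omega>} \<le> c"
  shows "measure (path_measure p K) {\<omega>. \<exists>i. A i \<omega> \<and> \<omega> (n i) = z i \<and> B (\<lambda>j. \<omega> (n i + j))} \<le>
    c * measure (path_measure p K) {\<omega>. \<exists>i. A i \<omega> \<and> \<omega> (n i) = z i}"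
proof -
  let ?M = "path_measure p K"
  interpret prob_space ?M by (rule prob_space_path_measure)
  \<comment> \<open>The index type is inhabited, so \<open>le\<close> has an instance, and it bounds
    \<open>c\<close> below by a probability.\<close>
  have c: "0 \<le> c" using le order_trans[OF measure_nonneg] by blast
  have pA: "Measurable.pred (PiM UNIV (\<lambda>_. count_space UNIV)) (A i)" for i
    by (rule pred_path_adapted[of "n i"]) (rule A)
  have m: "{\<omega>. A i \<omega> \<and> \<omega> (n i) = z i} \<in> sets ?M"
      "{\<omega>. A i \<omega> \<and> \<omega> (n i) = z i \<and> B (\<lambda>j. \<omega> (n i + j))} \<in> sets ?M" for i
    by (intro sets_Collect_path pred_intros_logic pred_path_coord pA pred_path_shift B)+
  have "emeasure ?M (\<Union>i. {\<omega>. A i \<omega> \<and> \<omega> (n i) = z i \<and> B (\<lambda>j. \<omega> (n i + j))}) =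
      (\<integral>\<^sup>+i. emeasure ?M {\<omega>. A i \<omega> \<and> \<omega> (n i) = z i \<and> B (\<lambda>j. \<omega> (n i + j))} \<partial>count_space UNIV)"
    using disj by (intro emeasure_UN_countable m) (auto simp: disjoint_family_on_def)
  also have "\<dots> \<le> (\<integral>\<^sup>+i. ennreal c * emeasure ?M {\<omega>. A i \<omega> \<and> \<omega> (n i) = z i} \<partial>count_space UNIV)"
  proof (rule nn_integral_mono)
    fix i
    have "measure ?M {\<omega>. A i \<omega> \<and> \<omega> (n i) = z i \<and> B (\<lambda>j. \<omega> (n i + j))} \<le>
        c * measure ?M {\<omega>. A i \<omega> \<and> \<omega> (n i) = z i}"
      by (subst path_markov[OF A B]) (simp_all add: mult.commute[of _ "measure ?M _"] mult.commute[of c] mult_left_mono le)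
    then show "emeasure ?M {\<omega>. A i \<omega> \<and> \<omega> (n i) = z i \<and> B (\<lambda>j. \<omega> (n i + j))} \<le>
        ennreal c * emeasure ?M {\<omega>. A i \<omega> \<and> \<omega> (n i) = z i}"
      by (simp add: emeasure_eq_measure ennreal_mult[symmetric] c)
  qed
  also have "\<dots> = ennreal c * emeasure ?M (\<Union>i. {\<omega>. A i \<omega> \<and> \<omega> (n i) = z i})"
    using disj by (subst emeasure_UN_countable[OF m(1)]) (auto simp: disjoint_family_on_def nn_integral_cmult)
  finally show ?thesis
    by (simp add: emeasure_eq_measure ennreal_mult[symmetric] c Collect_ex_eq[symmetric])
qed

section \<open>The limit set of a path\<close>

definition limit_set :: "(nat \<Rightarrow> 'a) \<Rightarrow> 'a set" where
  "limit_set \<omega> = {x. \<forall>m. \<exists>n\<ge>m. \<omega> n = x}"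

lemma pred_limit_set:
  "Measurable.pred (PiM UNIV (\<lambda>_. count_space (UNIV :: 'a set))) (\<lambda>\<omega>. x \<in> limit_set \<omega>)"
  unfolding limit_set_def mem_Collect_eq by (intro pred_intros_logic pred_intros_countable pred_path_coord)

lemma limit_set_shift: "limit_set (\<lambda>i. \<omega> (n + i)) = limit_set \<omega>"
proof -
  have "(\<forall>m. \<exists>k\<ge>m. \<omega> (n + k) = x) \<longleftrightarrow> (\<forall>m. \<exists>k\<ge>m. \<omega> k = x)" for x
  proof (intro iffI allI)
    fix m assume "\<forall>m. \<exists>k\<ge>m. \<omega> (n + k) = x"
    then obtain k where "k \<ge> m" "\<omega> (n + k) = x" by blast
    then show "\<exists>k\<ge>m. \<omega> k = x" by (intro exI[of _ "n + k"]) simp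
  next
    fix m assume "\<forall>m. \<exists>k\<ge>m. \<omega> k = x"
    then obtain k where "k \<ge> n + m" "\<omega> k = x" by blast
    then show "\<exists>k\<ge>m. \<omega> (n + k) = x" by (intro exI[of _ "k - n"]) simp
  qed
  then show ?thesis by (simp add: limit_set_def)
qed

text \<open>
  Let \<open>h z\<close> be the probability, from \<open>z\<close>, of visiting \<open>x\<close> infinitely often and \<open>y\<close> never.
  The first visit to \<open>x\<close> gives \<open>h z \<le> h x\<close>; looking \<open>n\<close> steps ahead, where \<open>n\<close> is chosen such
  that \<open>y\<close> is hit at time \<open>n\<close> with probability \<open>e > 0\<close>, gives \<open>h x \<le> (1 - e) * h x\<close>.
\<close>

lemma AE_limit_set_avoids:
  fixes K :: "'a::countable \<Rightarrow> 'a pmf"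
  assumes "accessible K x y"
  shows "AE \<omega> in path_measure (return_pmf z) K. \<not> (x \<in> limit_set \<omega> \<and> (\<forall>k. \<omega> k \<noteq> y))"
proof -
  let ?P = "\<lambda>z. path_measure (return_pmf z) K"
  define H where "H \<omega> \<longleftrightarrow> x \<in> limit_set \<omega> \<and> (\<forall>k. \<omega> k \<noteq> y)" for \<omega>
  define h where "h z = measure (?P z) {\<omega>. H \<omega>}" for z
  have H: "Measurable.pred (PiM UNIV (\<lambda>_. count_space UNIV)) H"
    unfolding H_def by (intro pred_intros_logic pred_intros_countable pred_path_coord pred_limit_set)
  have shift: "H (\<lambda>i. \<omega> (n + i))" if "H \<omega>" for \<omega> n
    using that by (simp add: H_def limit_set_shift)
  have h_nonneg: "0 \<le> h z" for z by (simp add: h_def)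
  have h_le: "h z \<le> h x" for z
  proof -
    interpret prob_space "?P z" by (rule prob_space_path_measure)
    let ?F = "\<lambda>k \<omega>. \<forall>j<k. \<omega> j \<noteq> x"
    have "\<exists>k. ?F k \<omega> \<and> \<omega> k = x \<and> H (\<lambda>j. \<omega> (k + j))" if "H \<omega>" for \<omega>
    proof -
      have "\<exists>k. \<omega> k = x" using that by (auto simp: H_def limit_set_def)
      then have "\<omega> (LEAST k. \<omega> k = x) = x" by (rule LeastI_ex)
      then show ?thesis
        by (intro exI[of _ "LEAST k. \<omega> k = x"] conjI allI impI shift[OF that]) (auto dest: not_less_Least)
    qed
    then have "h z \<le> measure (?P z) {\<omega>. \<exists>k. ?F k \<omega> \<and> \<omega> k = x \<and> H (\<lambda>j. \<omega> (k + j))}"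
      unfolding h_def
      by (intro finite_measure_mono sets_Collect_path pred_intros_logic pred_intros_countable
          pred_path_coord pred_path_shift H) auto
    also have "\<dots> \<le> h x * measure (?P z) {\<omega>. \<exists>k. ?F k \<omega> \<and> \<omega> k = x}"
      by (rule path_markov_le[OF _ _ H]) (auto simp: h_def, metis linorder_neqE_nat)
    also have "\<dots> \<le> h x * 1"
      by (intro mult_left_mono h_nonneg prob_le_1)
    finally show ?thesis by simp
  qed
  obtain n where n: "measure (?P x) {\<omega>. \<omega> n = y} > 0"
    using assms by (auto simp: accessible_def)
  interpret prob_space "?P x" by (rule prob_space_path_measure)
  have "h x \<le> measure (?P x) {\<omega>. \<exists>w. w \<noteq> y \<and> \<omega> n = w \<and> H (\<lambda>j. \<omega> (n + j))}"
    unfolding h_def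
    by (intro finite_measure_mono sets_Collect_path pred_intros_logic pred_intros_countable
        pred_path_coord pred_path_shift H) (use shift in \<open>auto simp: H_def\<close>)
  also have "\<dots> \<le> h x * measure (?P x) {\<omega>. \<exists>w. w \<noteq> y \<and> \<omega> n = w}"
    by (rule path_markov_le[OF _ _ H]) (use h_le in \<open>auto simp: h_def\<close>)
  also have "{\<omega>. \<exists>w. w \<noteq> y \<and> \<omega> n = w} = space (?P x) - {\<omega>. \<omega> n = y}"
    by auto
  also have "measure (?P x) \<dots> = 1 - measure (?P x) {\<omega>. \<omega> n = y}"
    by (intro prob_compl sets_Collect_path pred_path_coord)
  finally have "h x * measure (?P x) {\<omega>. \<omega> n = y} \<le> 0"
    by (simp add: algebra_simps)
  with n h_nonneg[of x] have "h x = 0"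
    by (simp add: mult_le_0_iff)
  with h_le[of z] h_nonneg[of z] have "h z = 0"
    by linarith
  then have "AE \<omega> in ?P z. \<not> H \<omega>"
    by (subst AE_path_iff) (auto intro: pred_intros_logic H simp: h_def)
  then show ?thesis by (simp add: H_def)
qed

text \<open>Avoidance is applied to every tail of the path. If \<open>y\<close> were visited only
  finitely often, some tail would never visit it, although that tail has the same limit set and so
  still visits \<open>x\<close> infinitely often.\<close>

lemma AE_limit_set_closed:
  fixes K :: "'a::countable \<Rightarrow> 'a pmf"
  shows "AE \<omega> in path_measure p K. \<forall>x y. x \<in> limit_set \<omega> \<longrightarrow> accessible K x y \<longrightarrow> y \<in> limit_set \<omega>"
proof -
  let ?B = "\<lambda>x y \<omega>. accessible K x y \<longrightarrow> \<not> (x \<in> limit_set \<omega> \<and> (\<forall>k. \<omega> k \<noteq> y))"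
  have "AE \<omega> in path_measure p K. \<omega> m = z \<longrightarrow> ?B x y (\<lambda>i. \<omega> (m + i))" for x y z m
  proof (rule AE_path_shift_iff[THEN iffD2, OF _ disjI2])
    show "Measurable.pred (PiM UNIV (\<lambda>_. count_space UNIV)) (?B x y)"
      by (intro pred_intros_logic pred_intros_countable pred_path_coord pred_limit_set)
    show "AE \<omega> in path_measure (return_pmf z) K. ?B x y \<omega>"
      using AE_limit_set_avoids[of K x y z] by (cases "accessible K x y") auto
  qed
  then have "AE \<omega> in path_measure p K. \<forall>x y z m. \<omega> m = z \<longrightarrow> ?B x y (\<lambda>i. \<omega> (m + i))"
    unfolding AE_all_countable by blast
  then show ?thesis
  proof eventually_elim
    case (elim \<omega>)
    have "\<exists>n\<ge>m. \<omega> n = y" if x: "x \<in> limit_set \<omega>" and xy: "accessible K x y" for x y m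
    proof -
      have "\<not> (x \<in> limit_set (\<lambda>i. \<omega> (m + i)) \<and> (\<forall>k. \<omega> (m + k) \<noteq> y))"
        using elim[THEN spec, THEN spec, THEN spec, THEN spec, THEN mp, THEN mp, OF refl xy] .
      then obtain k where "\<omega> (m + k) = y"
        using x unfolding limit_set_shift by blast
      then show ?thesis by (intro exI[of _ "m + k"]) simp
    qed
    then show ?case by (simp add: limit_set_def)
  qed
qed

section \<open>Recurrence classes of a finite chain\<close>

lemma pred_return:
  "Measurable.pred (PiM UNIV (\<lambda>_. count_space (UNIV :: 'a set))) (\<lambda>\<omega>. \<exists>k>0::nat. \<omega> k = x)"
  by measurable

lemma recurrent_iff_AE:
  "recurrent K x \<longleftrightarrow> (AE \<omega> in path_measure (return_pmf x) K. \<exists>k>0. \<omega> k = x)"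
  unfolding recurrent_def by (rule AE_path_eq_1[OF pred_return, symmetric])

text \<open>By the Markov property at each time \<open>n\<close>, every visit to \<open>x\<close> is
  almost surely followed by a later one; induction then produces visits beyond any bound.\<close>

lemma AE_recurrent_limit_set:
  fixes K :: "'a::countable \<Rightarrow> 'a pmf"
  assumes "recurrent K x"
  shows "AE \<omega> in path_measure (return_pmf x) K. x \<in> limit_set \<omega>"
proof -
  have "AE \<omega> in path_measure (return_pmf x) K. \<omega> n = x \<longrightarrow> (\<exists>k>0. \<omega> (n + k) = x)" for n
    using assms by (intro AE_path_shift_iff[OF pred_return, THEN iffD2] disjI2) (simp add: recurrent_iff_AE)
  then have "AE \<omega> in path_measure (return_pmf x) K. \<forall>n. \<omega> n = x \<longrightarrow> (\<exists>k>0. \<omega> (n + k) = x)"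
    unfolding AE_all_countable by blast
  with AE_path_return_0[of x K] show ?thesis
  proof eventually_elim
    case (elim \<omega>)
    have "\<exists>n\<ge>m. \<omega> n = x" for m
    proof (induction m)
      case (Suc m)
      then obtain n where "n \<ge> m" "\<omega> n = x" by blast
      moreover from this elim obtain k where "k > 0" "\<omega> (n + k) = x" by blast
      ultimately show ?case by (intro exI[of _ "n + k"]) simp
    qed (use elim in auto)
    then show ?case by (simp add: limit_set_def)
  qed
qed

lemma limit_set_accessible:
  assumes "\<forall>n i. accessible K (\<omega> n) (\<omega> (n + i))" "y \<in> limit_set \<omega>"
  shows "accessible K (\<omega> n) y"
proof -
  obtain m where "m \<ge> n" "\<omega> m = y" using assms(2) by (auto simp: limit_set_def)
  then show ?thesis using assms(1)[rule_format, of n "m - n"] by simp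
qed

lemma limit_set_communicate:
  assumes "\<forall>n i. accessible K (\<omega> n) (\<omega> (n + i))" "x \<in> limit_set \<omega>" "y \<in> limit_set \<omega>"
  shows "accessible K x y"
proof -
  obtain n where "\<omega> n = x" using assms(2) by (auto simp: limit_set_def)
  then show ?thesis using limit_set_accessible[OF assms(1,3), of n] by simp
qed

text \<open>From a recurrent \<open>x\<close> almost every path has \<open>x\<close>, and by closure
  also \<open>y\<close>, in its limit set. One such path leads from \<open>y\<close> back to
  \<open>x\<close>. For recurrence of \<open>y\<close>, these paths are restarted at a time when
  they are in \<open>y\<close> with positive probability.\<close>

lemma recurrent_accessible:
  fixes K :: "'a::countable \<Rightarrow> 'a pmf"
  assumes "recurrent K x" "accessible K x y"
  shows "accessible K y x" "recurrent K y"
proof -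
  let ?P = "path_measure (return_pmf x) K"
  have *: "AE \<omega> in ?P. x \<in> limit_set \<omega> \<and> y \<in> limit_set \<omega>"
    using AE_recurrent_limit_set[OF assms(1)] AE_limit_set_closed
    by eventually_elim (use assms(2) in blast)
  have "AE \<omega> in ?P. accessible K y x"
    using * AE_path_accessible by eventually_elim (rule limit_set_communicate, auto)
  from ex_path_of_AE[OF this] show "accessible K y x" by simp
  obtain n where n: "measure ?P {\<omega>. \<omega> n = y} > 0"
    using assms(2) by (auto simp: accessible_def)
  have "AE \<omega> in ?P. \<omega> n = y \<longrightarrow> (\<exists>k>0. \<omega> (n + k) = y)"
    using *
  proof eventually_elim
    case (elim \<omega>)
    then have "\<exists>m\<ge>Suc n. \<omega> m = y" by (simp add: limit_set_def)
    then obtain m where "m \<ge> Suc n" "\<omega> m = y" by blast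
    then show ?case by (intro impI exI[of _ "m - n"]) auto
  qed
  \<comment> \<open>The choice of \<open>n\<close> rules out the null-event alternative of
    \<open>AE_path_shift_iff\<close>.\<close>
  then show "recurrent K y"
    unfolding recurrent_iff_AE by (subst (asm) AE_path_shift_iff[OF pred_return]) (use n in auto)
qed

section \<open>Limit sets of paths in a finite set\<close>

lemma limit_set_nonempty:
  assumes "finite S" "\<forall>n. \<omega> n \<in> S"
  shows "limit_set \<omega> \<noteq> {}"
proof -
  have "\<exists>x. \<exists>\<^sub>\<infinity>n. \<omega> n = x"
    using pigeonhole_infinite[of "UNIV :: nat set" \<omega>] finite_subset[OF _ assms(1), of "range \<omega>"] assms(2)
    by (auto simp: INFM_iff_infinite)
  then show ?thesis by (auto simp: limit_set_def INFM_nat_le)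
qed

lemma limit_set_subset: "\<forall>n. \<omega> n \<in> S \<Longrightarrow> limit_set \<omega> \<subseteq> S"
  by (auto simp: limit_set_def)

lemma infinite_visits_iff_limit_set:
  assumes "finite S" "\<forall>n. \<omega> n \<in> S"
  shows "infinite {n. \<omega> n \<in> X} \<longleftrightarrow> X \<inter> limit_set \<omega> \<noteq> {}"
proof -
  have lim: "x \<in> limit_set \<omega> \<longleftrightarrow> infinite {n. \<omega> n = x}" for x
    by (simp add: limit_set_def INFM_nat_le[symmetric] INFM_iff_infinite)
  have "{n. \<omega> n \<in> X} = (\<Union>x\<in>X \<inter> S. {n. \<omega> n = x})"
    using assms(2) by auto
  then have "finite {n. \<omega> n \<in> X} \<longleftrightarrow> (\<forall>x\<in>X \<inter> S. finite {n. \<omega> n = x})"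
    using assms(1) by simp
  then show ?thesis
    using limit_set_subset[OF assms(2)] lim by blast
qed

text \<open>By finiteness some \<open>y\<close> is visited infinitely often. It is accessible from
  \<open>x\<close>, hence leads back to \<open>x\<close>, and closure of the limit set puts
  \<open>x\<close> into it; a visit at a time at least 1 is the required return.\<close>

lemma finite_closed_recurrent:
  fixes K :: "'a::countable \<Rightarrow> 'a pmf"
  assumes S: "finite S" "\<And>x. x \<in> S \<Longrightarrow> set_pmf (K x) \<subseteq> S"
    and x: "x \<in> S" "\<And>y. accessible K x y \<Longrightarrow> accessible K y x"
  shows "recurrent K x"
proof -
  have "AE \<omega> in path_measure (return_pmf x) K. \<forall>n. \<omega> n \<in> S"
    by (rule AE_path_invariant) (use S x in auto)
  with AE_path_return_0[of x K] AE_path_accessible AE_limit_set_closed show ?thesis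
    unfolding recurrent_iff_AE
  proof eventually_elim
    case (elim \<omega>)
    obtain y where y: "y \<in> limit_set \<omega>"
      using limit_set_nonempty[OF S(1)] elim by blast
    then have "accessible K x y"
      using limit_set_accessible[of K \<omega> y 0] elim by simp
    then have "x \<in> limit_set \<omega>" using x(2) y elim by blast
    then obtain n where "n \<ge> 1" "\<omega> n = x" by (auto simp: limit_set_def)
    then show ?case by (intro exI[of _ n]) simp
  qed
qed

text \<open>The second conjunct replaces the event of reaching \<open>R\<close> by the event that
  the limit set equals \<open>R\<close>; the latter events are disjoint for distinct
  \<open>R\<close> on all paths.\<close>

theorem AE_limit_set_recurrence_class:
  fixes K :: "'a::countable \<Rightarrow> 'a pmf"
  assumes S: "finite S" "\<And>x. x \<in> S \<Longrightarrow> set_pmf (K x) \<subseteq> S" and p: "set_pmf p \<subseteq> S"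
  shows "AE \<omega> in path_measure p K. limit_set \<omega> \<in> recurrence_classes S K \<and>
    (\<forall>R\<in>recurrence_classes S K. (\<exists>n. \<omega> n \<in> R) \<longleftrightarrow> limit_set \<omega> = R)"
proof -
  have "AE \<omega> in path_measure p K. \<forall>n. \<omega> n \<in> S"
    by (rule AE_path_invariant[OF p]) (rule S(2))
  then show ?thesis
    using AE_path_accessible AE_limit_set_closed
  proof eventually_elim
    case (elim \<omega>)
    let ?L = "limit_set \<omega>"
    let ?r = "{(x, y). x \<in> S \<and> y \<in> S \<and> recurrent K x \<and> recurrent K y \<and> communicate K x y}"
    have LS: "?L \<subseteq> S" and L0: "?L \<noteq> {}"
      using limit_set_nonempty[OF S(1)] limit_set_subset elim by auto
    have acc: "accessible K x y" if "x \<in> ?L" "y \<in> ?L" for x y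
      by (rule limit_set_communicate[OF elim(2) that])
    have closed: "y \<in> ?L" if "x \<in> ?L" "accessible K x y" for x y
      using elim(3) that by blast
    have rec: "recurrent K x" if "x \<in> ?L" for x
    proof (rule finite_closed_recurrent[OF S(1)])
      show "x \<in> S" using that LS by blast
      show "accessible K y x" if "accessible K x y" for y
        using acc closed \<open>x \<in> ?L\<close> that by blast
    qed (rule S(2))
    \<comment> \<open>Closure gives one inclusion; mutual accessibility and recurrence of all limit
      states give the other.\<close>
    have cls: "?r `` {x} = ?L" if "x \<in> ?L" for x
    proof (intro equalityI subsetI)
      fix y assume "y \<in> ?r `` {x}"
      then show "y \<in> ?L" using closed[OF that] by (simp add: communicate_def)
    next
      fix y assume "y \<in> ?L"
      moreover from this have "y \<in> S" using LS by blast
      moreover have "x \<in> S" using that LS by blast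
      ultimately show "y \<in> ?r `` {x}" using that acc rec by (simp add: communicate_def)
    qed
    have "?L \<in> recurrence_classes S K"
    proof -
      obtain x where "x \<in> ?L" using L0 by blast
      then have "x \<in> {x\<in>S. recurrent K x}" using LS rec by auto
      from quotientI[OF this, of ?r] show ?thesis
        unfolding recurrence_classes_def cls[OF \<open>x \<in> ?L\<close>] .
    qed
    \<comment> \<open>A path that meets \<open>R\<close> cannot end elsewhere: a limit state
      \<open>y\<close> is accessible from the representative \<open>x\<close> of \<open>R\<close>,
      recurrence of \<open>x\<close> makes \<open>x\<close> accessible from \<open>y\<close>, and
      closure brings \<open>x\<close> into the limit set.\<close>
    moreover have "?L = R" if R: "R \<in> recurrence_classes S K" and n: "\<omega> n \<in> R" for R n
    proof -
      obtain x where x: "x \<in> S" "recurrent K x" "R = ?r `` {x}"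
        using R by (auto simp: recurrence_classes_def quotient_def)
      obtain y where y: "y \<in> ?L" using L0 by blast
      have "accessible K x (\<omega> n)" using n x by (auto simp: communicate_def)
      then have xy: "accessible K x y"
        using limit_set_accessible[OF elim(2) y] by (rule accessible_trans)
      then have yx: "accessible K y x" using recurrent_accessible x by blast
      then have "x \<in> ?L" by (rule closed[OF y])
      show ?thesis unfolding x(3) cls[OF \<open>x \<in> ?L\<close>] by (rule refl)
    qed
    moreover have "\<exists>n. \<omega> n \<in> ?L"
    proof -
      obtain x where x: "x \<in> ?L" using L0 by blast
      then obtain n where "\<omega> n = x" by (auto simp: limit_set_def)
      with x show ?thesis by blast
    qed
    ultimately show ?case by blast
  qed
qed

section \<open>Acceptance and feasible recurrence classes\<close>

lemma pred_limit_set_eq: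
  "Measurable.pred (PiM UNIV (\<lambda>_. count_space (UNIV :: 'a::countable set))) (\<lambda>\<omega>. limit_set \<omega> = R)"
  unfolding set_eq_iff by (intro pred_intros_logic pred_intros_countable pred_limit_set) (rule measurable_const, simp)

lemma pred_rabin_accepting:
  assumes "finite F"
  shows "Measurable.pred (PiM UNIV (\<lambda>_. count_space (UNIV :: 'a set))) (\<lambda>\<omega>. rabin_accepting F (\<lambda>n. f (\<omega> n)))"
proof -
  have "(\<lambda>\<omega>. rabin_accepting F (\<lambda>n. f (\<omega> n))) =
    (\<lambda>\<omega>. \<exists>P\<in>F. \<not> (\<forall>m. \<exists>n\<ge>m. f (\<omega> n) \<in> fst P) \<and> (\<forall>m. \<exists>n\<ge>m. f (\<omega> n) \<in> snd P))"
    unfolding INFM_nat_le[symmetric] INFM_iff_infinite by (auto simp: rabin_accepting_def fun_eq_iff split_beta)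
  moreover have "Measurable.pred (PiM UNIV (\<lambda>_. count_space (UNIV :: 'a set))) \<dots>"
    by (intro pred_intros_finite[OF assms] pred_intros_logic pred_intros_countable)
      (rule pred_path_coord[where Q = "\<lambda>x. f x \<in> _"] | rule measurable_const, simp)+
  ultimately show ?thesis by simp
qed

lemma rabin_accepting_iff_limit_set:
  assumes "finite S" "\<forall>n. \<omega> n \<in> S"
  shows "rabin_accepting F (\<lambda>n. f (\<omega> n)) \<longleftrightarrow>
    (\<exists>(L, K)\<in>F. K \<inter> f ` limit_set \<omega> \<noteq> {} \<and> L \<inter> f ` limit_set \<omega> = {})"
proof -
  have "infinite {n. f (\<omega> n) \<in> X} \<longleftrightarrow> X \<inter> f ` limit_set \<omega> \<noteq> {}" for X
    using infinite_visits_iff_limit_set[OF assms, of "f -` X"] by auto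
  then show ?thesis
    unfolding rabin_accepting_def by (intro bex_cong refl) auto
qed

lemma set_gmc_step:
  fixes G :: "('x, 'ud::finite, 'ua::finite, 'od::finite, 'oa::finite, 'm) game_scheme"
  assumes "Cd \<in> FSC" "Ca \<in> FSC" "z \<in> gmc_states Cd Ca"
  shows "set_pmf (gmc_step G Cd Ca z) \<subseteq> gmc_states Cd Ca"
  using assms
  by (cases z) (fastforce simp: gmc_step_def gmc_prob_eq_pmf embed_pmf_pmf play_stage_def gmc_states_def FSC_def)

text \<open>Acceptance depends only on the limit set, which is almost surely a recurrence class.
  Additivity is applied to the events \<open>limit_set \<omega> = R\<close>, which are genuinely
  disjoint, and each is exchanged for its reachability event only afterwards.\<close>

lemma gmc_sat_prob_eq_reach:
  fixes G :: "('x::finite, 'ud::finite, 'ua::finite, 'od::finite, 'oa::finite) rabin_game"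
  assumes C: "Cd \<in> FSC" "Ca \<in> FSC"
  shows "gmc_sat_prob G Cd Ca = (\<Sum>R\<in>rec_sets G Cd Ca. reach_prob G Cd Ca R)"
proof -
  let ?S = "gmc_states Cd Ca :: ('x \<times> nat \<times> nat) set"
  let ?M = "gmc_paths G Cd Ca"
  let ?K = "gmc_step G Cd Ca"
  interpret prob_space ?M unfolding gmc_paths_def by (rule prob_space_path_measure)
  have S: "finite ?S" using C by (simp add: FSC_def gmc_states_def)
  have K: "\<And>x. x \<in> ?S \<Longrightarrow> set_pmf (?K x) \<subseteq> ?S" using C by (rule set_gmc_step)
  have p: "set_pmf (return_pmf (g_init G, fsc_init Cd, fsc_init Ca)) \<subseteq> ?S"
    using C by (simp add: FSC_def gmc_states_def)
  have AE_class: "AE \<omega> in ?M. limit_set \<omega> \<in> recurrence_classes ?S ?K \<and>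
    (\<forall>R\<in>recurrence_classes ?S ?K. (\<exists>n. \<omega> n \<in> R) \<longleftrightarrow> limit_set \<omega> = R)"
    unfolding gmc_paths_def by (rule AE_limit_set_recurrence_class[OF S _ p]) (rule K)
  have AE_S: "AE \<omega> in ?M. \<forall>n. \<omega> n \<in> ?S"
    unfolding gmc_paths_def by (rule AE_path_invariant[OF p]) (rule K)
  have fin: "finite (g_pairs G)" by simp
  have msets: "{\<omega>. limit_set \<omega> = R} \<in> sets ?M" for R
    unfolding gmc_paths_def by (intro sets_Collect_path pred_limit_set_eq)
  have "gmc_sat_prob G Cd Ca = measure ?M (\<Union>R\<in>rec_sets G Cd Ca. {\<omega>. limit_set \<omega> = R})"
    unfolding gmc_sat_prob_def
  proof (rule measure_eq_AE)
    show "AE \<omega> in ?M. (\<omega> \<in> {\<omega>. rabin_accepting (g_pairs G) (\<lambda>n. fst (\<omega> n))}) =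
        (\<omega> \<in> (\<Union>R\<in>rec_sets G Cd Ca. {\<omega>. limit_set \<omega> = R}))"
      using AE_class AE_S
      by eventually_elim (auto simp: rabin_accepting_iff_limit_set[OF S] rec_sets_def feasible_def)
    show "{\<omega>. rabin_accepting (g_pairs G) (\<lambda>n. fst (\<omega> n))} \<in> sets ?M"
      unfolding gmc_paths_def by (intro sets_Collect_path pred_rabin_accepting fin)
    show "(\<Union>R\<in>rec_sets G Cd Ca. {\<omega>. limit_set \<omega> = R}) \<in> sets ?M"
      using finite_rec_sets[OF C] msets by (intro sets.finite_UN)
  qed
  also have "\<dots> = (\<Sum>R\<in>rec_sets G Cd Ca. measure ?M {\<omega>. limit_set \<omega> = R})"
    using finite_rec_sets[OF C] msets by (intro finite_measure_finite_Union) (auto simp: disjoint_family_on_def)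
  also have "\<dots> = (\<Sum>R\<in>rec_sets G Cd Ca. reach_prob G Cd Ca R)"
  proof (rule sum.cong[OF refl])
    fix R assume R: "R \<in> rec_sets G Cd Ca"
    show "measure ?M {\<omega>. limit_set \<omega> = R} = reach_prob G Cd Ca R"
      unfolding reach_prob_def
    proof (rule measure_eq_AE[OF _ msets])
      show "AE \<omega> in ?M. (\<omega> \<in> {\<omega>. limit_set \<omega> = R}) = (\<omega> \<in> {\<omega>. \<exists>n. \<omega> n \<in> R})"
        using AE_class by eventually_elim (use R in \<open>auto simp: rec_sets_def\<close>)
      show "{\<omega>. \<exists>n. \<omega> n \<in> R} \<in> sets ?M"
        unfolding gmc_paths_def by (intro sets_Collect_path pred_intros_countable pred_path_coord)
    qed
  qed
  finally show ?thesis .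
qed

section \<open>Executions and the global Markov chain\<close>

text \<open>Countable additivity over the initial state. It mediates between point starts, for which
  the Markov property is stated, and the random start that a transition produces.\<close>

lemma emeasure_path_mixture:
  fixes K :: "'a::countable \<Rightarrow> 'a pmf"
  assumes B: "Measurable.pred (PiM UNIV (\<lambda>_. count_space UNIV)) B"
  shows "emeasure (path_measure p K) {\<omega>. B \<omega>} =
    (\<integral>\<^sup>+x. emeasure (path_measure (return_pmf x) K) {\<omega>. B \<omega>} \<partial>measure_pmf p)"
proof -
  let ?M = "path_measure p K"
  have *: "emeasure ?M {\<omega>. \<omega> 0 = x \<and> B \<omega>} =
      ennreal (pmf p x) * emeasure (path_measure (return_pmf x) K) {\<omega>. B \<omega>}" for x
    using emeasure_path_prefix_shift[OF B, of p K 0 "\<lambda>_. x"] emeasure_path_cylinder[of p K 0 "\<lambda>_. x"]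
    by simp
  have "emeasure ?M {\<omega>. B \<omega>} = emeasure ?M (\<Union>x. {\<omega>. \<omega> 0 = x \<and> B \<omega>})"
    by (rule arg_cong[where f = "emeasure ?M"]) auto
  also have "\<dots> = (\<integral>\<^sup>+x. emeasure ?M {\<omega>. \<omega> 0 = x \<and> B \<omega>} \<partial>count_space UNIV)"
    by (intro emeasure_UN_countable sets_Collect_path pred_intros_logic pred_path_coord B)
      (auto simp: disjoint_family_on_def)
  finally show ?thesis
    by (simp only: * nn_integral_measure_pmf)
qed

lemma distr_path_shift_1:
  fixes K :: "'a::countable \<Rightarrow> 'a pmf"
  shows "distr (path_measure (return_pmf x) K) (PiM UNIV (\<lambda>_. count_space UNIV)) (\<lambda>\<omega> i. \<omega> (1 + i)) =
    path_measure (K x) K" (is "?N = _")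
proof (rule measure_eqI_cylinders)
  let ?P = "path_measure (return_pmf x) K"
  interpret P: prob_space ?P by (rule prob_space_path_measure)
  have m: "(\<lambda>\<omega> i. \<omega> (1 + i)) \<in> measurable ?P (PiM UNIV (\<lambda>_. count_space UNIV))"
    unfolding measurable_cong_sets[OF sets_path_measure refl] by (rule measurable_path_shift)
  show "finite_measure ?N"
    by (rule P.finite_measure_distr[OF m])
  fix n and y :: "nat \<Rightarrow> 'a"
  let ?C = "{\<omega>. \<forall>i\<le>n. \<omega> i = y i}"
  have pC: "Measurable.pred (PiM UNIV (\<lambda>_. count_space UNIV)) (\<lambda>\<omega>. \<forall>i\<le>n. \<omega> i = y i)"
    by measurable
  have C: "?C \<in> sets (PiM UNIV (\<lambda>_. count_space UNIV))"
    using pC by (simp add: pred_def space_PiM)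
  have "emeasure ?N ?C = emeasure ?P {\<omega>. \<forall>i\<le>n. \<omega> (1 + i) = y i}"
    by (subst emeasure_distr[OF m C]) (simp add: vimage_def)
  \<comment> \<open>The path starts in \<open>x\<close> almost surely, so prescribing coordinate 0
    changes nothing and yields a cylinder from time 0.\<close>
  also have "\<dots> = emeasure ?P {\<omega>. \<forall>i\<le>Suc n. \<omega> i = (case i of 0 \<Rightarrow> x | Suc j \<Rightarrow> y j)}"
  proof (rule emeasure_eq_AE)
    show "AE \<omega> in ?P. (\<omega> \<in> {\<omega>. \<forall>i\<le>n. \<omega> (1 + i) = y i}) =
        (\<omega> \<in> {\<omega>. \<forall>i\<le>Suc n. \<omega> i = (case i of 0 \<Rightarrow> x | Suc j \<Rightarrow> y j)})"
      using AE_path_return_0[of x K]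
    proof eventually_elim
      case (elim \<omega>)
      have "(\<forall>i\<le>Suc n. Q i) \<longleftrightarrow> Q 0 \<and> (\<forall>i\<le>n. Q (Suc i))" for Q
        by (metis Suc_le_mono le0 not0_implies_Suc)
      then show ?case using elim by simp
    qed
    show "{\<omega>. \<forall>i\<le>n. \<omega> (1 + i) = y i} \<in> sets ?P"
      by (rule sets_Collect_path) (rule pred_path_shift[OF pC])
    show "{\<omega>. \<forall>i\<le>Suc n. \<omega> i = (case i of 0 \<Rightarrow> x | Suc j \<Rightarrow> y j)} \<in> sets ?P"
      by (rule sets_Collect_path) measurable
  qed
  also have "\<dots> = emeasure (path_measure (K x) K) ?C"
    by (simp add: emeasure_path_cylinder prod.lessThan_Suc_shift del: prod.lessThan_Suc)
  finally show "emeasure ?N ?C = emeasure (path_measure (K x) K) ?C" .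
qed (simp_all add: sets_path_measure)

text \<open>The recursion for inductions on the length of a cylinder. The first state is tested by a
  predicate because, in the refinement below, only its image under \<open>f\<close> is
  prescribed.\<close>

lemma emeasure_path_step:
  fixes K :: "'a::countable \<Rightarrow> 'a pmf"
  assumes B: "Measurable.pred (PiM UNIV (\<lambda>_. count_space UNIV)) B"
  shows "emeasure (path_measure p K) {\<omega>. Q (\<omega> 0) \<and> B (\<lambda>i. \<omega> (1 + i))} =
    (\<integral>\<^sup>+x. indicator {x. Q x} x * emeasure (path_measure (K x) K) {\<omega>. B \<omega>} \<partial>measure_pmf p)"
proof -
  have pS: "Measurable.pred (PiM UNIV (\<lambda>_. count_space UNIV)) (\<lambda>\<omega>. B (\<lambda>i. \<omega> (1 + i)))"
    by (rule pred_path_shift[OF B])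
  have pQ: "Measurable.pred (PiM UNIV (\<lambda>_. count_space UNIV)) (\<lambda>\<omega>. Q (\<omega> 0) \<and> B (\<lambda>i. \<omega> (1 + i)))"
    by (intro pred_intros_logic pred_path_coord pS)
  have "emeasure (path_measure (return_pmf x) K) {\<omega>. Q (\<omega> 0) \<and> B (\<lambda>i. \<omega> (1 + i))} =
      indicator {x. Q x} x * emeasure (path_measure (K x) K) {\<omega>. B \<omega>}" for x
  proof -
    let ?P = "path_measure (return_pmf x) K"
    have m: "(\<lambda>\<omega> i. \<omega> (1 + i)) \<in> measurable ?P (PiM UNIV (\<lambda>_. count_space UNIV))"
      unfolding measurable_cong_sets[OF sets_path_measure refl] by (rule measurable_path_shift)
    have sB: "{\<omega>. B \<omega>} \<in> sets (PiM UNIV (\<lambda>_. count_space UNIV))"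
      using B by (simp add: pred_def space_PiM)
    have "emeasure ?P {\<omega>. Q (\<omega> 0) \<and> B (\<lambda>i. \<omega> (1 + i))} = emeasure ?P {\<omega>. Q x \<and> B (\<lambda>i. \<omega> (1 + i))}"
    proof (rule emeasure_eq_AE)
      show "{\<omega>. Q x \<and> B (\<lambda>i. \<omega> (1 + i))} \<in> sets ?P"
        by (cases "Q x") (simp_all add: sets_Collect_path[OF pS, simplified])
      show "AE \<omega> in ?P. (\<omega> \<in> {\<omega>. Q (\<omega> 0) \<and> B (\<lambda>i. \<omega> (1 + i))}) = (\<omega> \<in> {\<omega>. Q x \<and> B (\<lambda>i. \<omega> (1 + i))})"
        using AE_path_return_0[of x K] by eventually_elim simp
    qed (rule sets_Collect_path[OF pQ])
    also have "\<dots> = indicator {x. Q x} x * emeasure ?P {\<omega>. B (\<lambda>i. \<omega> (1 + i))}"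
      by (cases "Q x") simp_all
    also have "emeasure ?P {\<omega>. B (\<lambda>i. \<omega> (1 + i))} = emeasure (path_measure (K x) K) {\<omega>. B \<omega>}"
      unfolding distr_path_shift_1[of x K, symmetric] emeasure_distr[OF m sB] by (simp add: vimage_def)
    finally show ?thesis .
  qed
  then show ?thesis
    by (subst emeasure_path_mixture[OF pQ]) simp
qed

text \<open>
  The process \<open>f (t 0), f (t 1), \<dots>\<close> is a Markov chain although the law of \<open>f (t (n + 1))\<close>
  depends on all of \<open>t n\<close>: each \<open>t n\<close> is drawn afresh from \<open>f (t n)\<close>.
\<close>

lemma distr_path_refinement:
  fixes play :: "'a::countable \<Rightarrow> 't::countable pmf" and h :: "'t \<Rightarrow> 'a pmf"
  assumes f: "\<And>z t. t \<in> set_pmf (play z) \<Longrightarrow> f t = z"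
  shows "distr (path_measure (play z) (\<lambda>t. bind_pmf (h t) play)) (PiM UNIV (\<lambda>_. count_space UNIV))
      (\<lambda>\<omega> n. f (\<omega> n)) =
    path_measure (return_pmf z) (\<lambda>z. bind_pmf (play z) h)" (is "?N = _")
proof (rule measure_eqI_cylinders)
  let ?K = "\<lambda>t. bind_pmf (h t) play" and ?K' = "\<lambda>z. bind_pmf (play z) h"
  interpret prob_space "path_measure (play z) ?K" by (rule prob_space_path_measure)
  have "(\<lambda>\<omega> n :: nat. f (\<omega> n)) \<in> measurable (PiM UNIV (\<lambda>_. count_space UNIV)) (PiM UNIV (\<lambda>_. count_space UNIV))"
  proof (rule measurable_PiM_single')
    show "(\<lambda>\<omega> n :: nat. f (\<omega> n)) \<in> space (PiM UNIV (\<lambda>_. count_space UNIV)) \<rightarrow> (UNIV \<rightarrow>\<^sub>E space (count_space UNIV))"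
      by (simp only: space_PiM space_count_space PiE_UNIV) auto
    show "(\<lambda>\<omega>. f (\<omega> n)) \<in> measurable (PiM UNIV (\<lambda>_. count_space UNIV)) (count_space UNIV)" for n :: nat
      by (rule measurable_compose[OF measurable_path_coord measurable_count_space])
  qed
  then have m: "(\<lambda>\<omega> n. f (\<omega> n)) \<in> measurable (path_measure (play z) ?K) (PiM UNIV (\<lambda>_. count_space UNIV))"
    by (simp add: measurable_cong_sets[OF sets_path_measure refl])
  show "finite_measure ?N" by (rule finite_measure_distr[OF m])
  have step: "(\<forall>i\<le>Suc n. Q i) \<longleftrightarrow> Q 0 \<and> (\<forall>i\<le>n. Q (1 + i))" for Q and n :: nat
    by (metis Suc_le_mono le0 not0_implies_Suc plus_1_eq_Suc)
  have pc: "Measurable.pred (PiM UNIV (\<lambda>_. count_space UNIV)) (\<lambda>\<omega>. \<forall>i\<le>n. g (\<omega> i) = zs i)"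
    for n :: nat and g :: "'t \<Rightarrow> 'a" and zs
    by (rule pred_path_adapted[where n = n]) simp
  have pc': "Measurable.pred (PiM UNIV (\<lambda>_. count_space UNIV)) (\<lambda>\<omega>. \<forall>i\<le>n. \<omega> i = zs i)"
    for n :: nat and zs :: "nat \<Rightarrow> 'a"
    by (rule pred_path_adapted[where n = n]) simp
  \<comment> \<open>The start \<open>z\<close> is generalised because after one round it becomes a
    random state drawn from \<open>h t\<close>.\<close>
  have cyl: "emeasure (path_measure (play z) ?K) {\<omega>. \<forall>i\<le>n. f (\<omega> i) = zs i} =
      emeasure (path_measure (return_pmf z) ?K') {\<omega>. \<forall>i\<le>n. \<omega> i = zs i}" for n z zs
  proof (induction n arbitrary: z zs)
    case 0
    interpret P: prob_space "path_measure (play z) ?K" by (rule prob_space_path_measure)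
    have "emeasure (path_measure (play z) ?K) {\<omega>. f (\<omega> 0) = zs 0} =
        emeasure (path_measure (play z) ?K) (if z = zs 0 then space (path_measure (play z) ?K) else {})"
    proof (rule emeasure_eq_AE)
      show "AE \<omega> in path_measure (play z) ?K. (\<omega> \<in> {\<omega>. f (\<omega> 0) = zs 0}) =
          (\<omega> \<in> (if z = zs 0 then space (path_measure (play z) ?K) else {}))"
        using AE_path_0[of "play z" ?K] by eventually_elim (simp add: f)
      show "(if z = zs 0 then space (path_measure (play z) ?K) else {}) \<in> sets (path_measure (play z) ?K)"
        by (split if_split) (blast intro: sets.top sets.empty_sets)
    qed (rule sets_Collect_path, rule pred_path_coord)
    then show ?case
      using emeasure_path_cylinder[of "return_pmf z" ?K' 0 zs] P.emeasure_space_1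
      by (cases "z = zs 0") simp_all
  next
    case (Suc n)
    let ?zs = "\<lambda>i. zs (1 + i)"
    let ?c = "\<lambda>w. emeasure (path_measure (return_pmf w) ?K') {\<omega>. \<forall>i\<le>n. \<omega> i = ?zs i}"
    have "emeasure (path_measure (play z) ?K) {\<omega>. \<forall>i\<le>Suc n. f (\<omega> i) = zs i} =
        (\<integral>\<^sup>+t. indicator {t. f t = zs 0} t *
          emeasure (path_measure (?K t) ?K) {\<omega>. \<forall>i\<le>n. f (\<omega> i) = ?zs i} \<partial>measure_pmf (play z))"
      unfolding step by (rule emeasure_path_step[OF pc])
    \<comment> \<open>Every \<open>t\<close> drawn from \<open>play z\<close> has
      \<open>f t = z\<close>, so the test no longer depends on \<open>t\<close> and leaves the
      integral.\<close>
    also have "\<dots> = (\<integral>\<^sup>+t. indicator {zs 0} z *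
          emeasure (path_measure (?K t) ?K) {\<omega>. \<forall>i\<le>n. f (\<omega> i) = ?zs i} \<partial>measure_pmf (play z))"
      by (intro nn_integral_cong_AE AE_pmfI) (simp add: f indicator_def)
    also have "\<dots> = indicator {zs 0} z *
        (\<integral>\<^sup>+t. emeasure (path_measure (?K t) ?K) {\<omega>. \<forall>i\<le>n. f (\<omega> i) = ?zs i} \<partial>measure_pmf (play z))"
      by (rule nn_integral_cmult) simp
    also have "(\<integral>\<^sup>+t. emeasure (path_measure (?K t) ?K) {\<omega>. \<forall>i\<le>n. f (\<omega> i) = ?zs i} \<partial>measure_pmf (play z)) =
        (\<integral>\<^sup>+t. (\<integral>\<^sup>+w. emeasure (path_measure (play w) ?K) {\<omega>. \<forall>i\<le>n. f (\<omega> i) = ?zs i} \<partial>measure_pmf (h t))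
          \<partial>measure_pmf (play z))"
      by (intro nn_integral_cong) (subst (1 2) emeasure_path_mixture[OF pc], simp)
    also have "\<dots> = (\<integral>\<^sup>+w. ?c w \<partial>measure_pmf (?K' z))"
      by (simp only: Suc.IH nn_integral_bind_pmf)
    also have "\<dots> = emeasure (path_measure (?K' z) ?K') {\<omega>. \<forall>i\<le>n. \<omega> i = ?zs i}"
      by (rule emeasure_path_mixture[OF pc', symmetric])
    also have "indicator {zs 0} z * \<dots> = emeasure (path_measure (return_pmf z) ?K') {\<omega>. \<forall>i\<le>Suc n. \<omega> i = zs i}"
      unfolding step by (subst emeasure_path_step[OF pc']) (simp add: indicator_def)
    finally show ?case .
  qed
  fix n and y :: "nat \<Rightarrow> 'a"
  have "{\<omega>. \<forall>i\<le>n. \<omega> i = y i} \<in> sets (PiM UNIV (\<lambda>_. count_space UNIV))"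
    using pc' by (simp add: pred_def space_PiM)
  from emeasure_distr[OF m this]
  show "emeasure ?N {\<omega>. \<forall>i\<le>n. \<omega> i = y i} = emeasure (path_measure (return_pmf z) ?K') {\<omega>. \<forall>i\<le>n. \<omega> i = y i}"
    by (simp add: vimage_def cyl)
qed (simp_all add: sets_path_measure)

text \<open>The path lemmas ask for a countable state type, and a stage contains natural numbers as
  internal states. The instance is for \<open>stage_ext\<close>, the type constructor behind the
  record.\<close>

instance stage_ext :: (countable, countable, countable, countable, countable, countable) countable
proof
  let ?f = "\<lambda>t :: ('a, 'b, 'c, 'd, 'e, 'f) stage_ext. to_nat (st_state t, st_gd t, st_ga t, st_od t, st_oa t,
    st_ud t, st_ua t, st_gd_next t, st_ga_next t, stage.more t)"
  have "inj ?f"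
    by (rule injI) (simp add: stage.equality)
  then show "\<exists>f :: ('a, 'b, 'c, 'd, 'e, 'f) stage_ext \<Rightarrow> nat. inj f" by blast
qed

lemma set_play_stage:
  assumes "t \<in> set_pmf (play_stage G Cd Ca x gd ga)"
  shows "st_state t = x" "st_gd t = gd" "st_ga t = ga"
  using assms by (auto simp: play_stage_def)

text \<open>One round consists of two draws: \<open>play\<close> draws observations, actions and
  next internal states from a global state, and \<open>h\<close> draws the next game state from a
  stage. Executions iterate \<open>h\<close> followed by \<open>play\<close>, the global Markov
  chain iterates \<open>play\<close> followed by \<open>h\<close>, so the two are the same
  alternation observed at different points.\<close>

lemma distr_executions:
  fixes G :: "('x::finite, 'ud::finite, 'ua::finite, 'od::finite, 'oa::finite, 'm) game_scheme"
  shows "distr (executions G Cd Ca) (PiM UNIV (\<lambda>_. count_space UNIV))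
      (\<lambda>\<omega> n. (st_state (\<omega> n), st_gd (\<omega> n), st_ga (\<omega> n))) = gmc_paths G Cd Ca"
proof -
  define play where "play = (\<lambda>(x, gd, ga). play_stage G Cd Ca x gd ga)"
  define h where "h t = map_pmf (\<lambda>x'. (x', st_gd_next t, st_ga_next t))
    (g_trans G (st_state t) (st_ud t) (st_ua t))" for t :: "('x, 'ud, 'ua, 'od, 'oa) stage"
  have next_stage: "next_stage G Cd Ca = (\<lambda>t. bind_pmf (h t) play)"
    by (simp add: fun_eq_iff next_stage_def h_def play_def bind_map_pmf)
  have gmc: "gmc_step G Cd Ca = (\<lambda>z. bind_pmf (play z) h)"
  proof
    fix z :: "'x \<times> nat \<times> nat"
    obtain x gd ga where z: "z = (x, gd, ga)" by (cases z)
    have "gmc_step G Cd Ca z = bind_pmf (play_stage G Cd Ca x gd ga) (\<lambda>t.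
      map_pmf (\<lambda>x'. (x', st_gd_next t, st_ga_next t)) (g_trans G x (st_ud t) (st_ua t)))"
      by (simp add: z gmc_step_def gmc_prob_eq_pmf embed_pmf_pmf)
    \<comment> \<open>\<open>h\<close> reads the game state from the stage, and on the support of
      \<open>play_stage\<close> that is \<open>x\<close>.\<close>
    also have "\<dots> = bind_pmf (play z) h"
      by (rule bind_pmf_cong) (simp_all add: z play_def h_def set_play_stage)
    finally show "gmc_step G Cd Ca z = bind_pmf (play z) h" .
  qed
  have "distr (path_measure (play (g_init G, fsc_init Cd, fsc_init Ca)) (\<lambda>t. bind_pmf (h t) play))
      (PiM UNIV (\<lambda>_. count_space UNIV)) (\<lambda>\<omega> n. (st_state (\<omega> n), st_gd (\<omega> n), st_ga (\<omega> n))) =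
    path_measure (return_pmf (g_init G, fsc_init Cd, fsc_init Ca)) (\<lambda>z. bind_pmf (play z) h)"
    by (rule distr_path_refinement[where f = "\<lambda>t. (st_state t, st_gd t, st_ga t)"])
      (auto simp: play_def set_play_stage)
  then show ?thesis
    by (simp add: executions_def gmc_paths_def next_stage gmc) (simp add: play_def)
qed

section \<open>Acceptance along an execution\<close>

lemma rabin_accepting_product_game:
  "rabin_accepting (g_pairs (product_game G A)) r \<longleftrightarrow> rabin_accepting (dra_pairs A) (\<lambda>n. snd (r n))"
proof -
  have "g_pairs (product_game G A) = (\<lambda>P. ({x. snd x \<in> fst P}, {x. snd x \<in> snd P})) ` dra_pairs A"
    by (force simp: product_game_def case_prod_unfold)
  then show ?thesis by (simp add: rabin_accepting_def case_prod_unfold)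
qed

text \<open>A product transition has probability zero unless the automaton component moves by the
  label of the new game state. This is why the letter read at step \<open>n\<close> is the label at
  time \<open>Suc n\<close>.\<close>

lemma AE_executions_dra_run:
  fixes G :: "('s::finite, 'ud::finite, 'ua::finite, 'od::finite, 'oa::finite, 'ap) posg"
    and A :: "('q::finite, 'ap) dra"
  shows "AE \<omega> in executions (product_game G A) Cd Ca.
    dra_run A (\<lambda>n. g_label G (fst (st_state (\<omega> (Suc n))))) (\<lambda>n. snd (st_state (\<omega> n)))"
  using AE_path_0 AE_path_step unfolding executions_def
proof eventually_elim
  case (elim \<omega>)
  have "snd (st_state (\<omega> 0)) = dra_init A"
    using set_play_stage(1)[OF elim(1)] by (simp add: product_game_def)
  moreover have "snd (st_state (\<omega> (Suc n))) =
      dra_delta A (snd (st_state (\<omega> n))) (g_label G (fst (st_state (\<omega> (Suc n)))))" for n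
  proof -
    let ?T = "g_trans (product_game G A) (st_state (\<omega> n)) (st_ud (\<omega> n)) (st_ua (\<omega> n))"
    obtain x' where "x' \<in> set_pmf ?T"
      "\<omega> (Suc n) \<in> set_pmf (play_stage (product_game G A) Cd Ca x' (st_gd_next (\<omega> n)) (st_ga_next (\<omega> n)))"
      using elim(2)[rule_format, of n] by (auto simp: next_stage_def)
    then have "st_state (\<omega> (Suc n)) \<in> set_pmf ?T"
      by (simp add: set_play_stage)
    then have "product_prob G A (st_state (\<omega> n)) (st_ud (\<omega> n)) (st_ua (\<omega> n)) (st_state (\<omega> (Suc n))) \<noteq> 0"
      by (simp add: set_pmf_iff pmf_product_game)
    then show ?thesis
      by (auto simp: product_prob_def case_prod_unfold split: if_splits)
  qed
  ultimately show ?case by (simp add: dra_run_def)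
qed

text \<open>The automaton component is almost surely the run, so only acceptance remains; that event
  is the preimage of acceptance in the global Markov chain under forgetting observations and
  actions.\<close>

lemma exec_sat_prob_eq_gmc_sat_prob:
  fixes G :: "('s::finite, 'ud::finite, 'ua::finite, 'od::finite, 'oa::finite, 'ap) posg"
    and A :: "('q::finite, 'ap) dra"
  shows "exec_sat_prob G A Cd Ca = gmc_sat_prob (product_game G A) Cd Ca"
proof -
  let ?G = "product_game G A"
  let ?E = "executions ?G Cd Ca"
  let ?\<Pi> = "PiM UNIV (\<lambda>_. count_space UNIV)"
  let ?run = "\<lambda>\<omega> :: nat \<Rightarrow> ('s \<times> 'q, 'ud, 'ua, 'od, 'oa) stage. dra_run A (\<lambda>n. g_label G (fst (st_state (\<omega> (Suc n))))) (\<lambda>n. snd (st_state (\<omega> n)))"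
  let ?f = "\<lambda>(\<omega> :: nat \<Rightarrow> ('s \<times> 'q, 'ud, 'ua, 'od, 'oa) stage) n. (st_state (\<omega> n), st_gd (\<omega> n), st_ga (\<omega> n))"
  let ?acc = "\<lambda>\<omega> :: nat \<Rightarrow> ('s \<times> 'q, 'ud, 'ua, 'od, 'oa) stage. rabin_accepting (dra_pairs A) (\<lambda>n. snd (st_state (\<omega> n)))"
  have acc: "Measurable.pred ?\<Pi> ?acc"
    by (rule pred_rabin_accepting[where f = "\<lambda>t. snd (st_state t)"]) simp
  have run: "Measurable.pred ?\<Pi> ?run"
  proof -
    have "Measurable.pred ?\<Pi> (\<lambda>\<omega> :: nat \<Rightarrow> ('s \<times> 'q, 'ud, 'ua, 'od, 'oa) stage. snd (st_state (\<omega> (Suc n))) =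
      dra_delta A (snd (st_state (\<omega> n))) (g_label G (fst (st_state (\<omega> (Suc n))))))" for n
      by (rule pred_path_adapted[where n = "Suc n"]) simp
    moreover have "Measurable.pred ?\<Pi> (\<lambda>\<omega> :: nat \<Rightarrow> ('s \<times> 'q, 'ud, 'ua, 'od, 'oa) stage. snd (st_state (\<omega> 0)) = dra_init A)"
      by (rule pred_path_adapted[where n = 0]) simp
    ultimately show ?thesis
      unfolding dra_run_def by (intro pred_intros_logic pred_intros_countable)
  qed
  have "exec_sat_prob G A Cd Ca = measure ?E {\<omega>. ?acc \<omega>}"
    unfolding exec_sat_prob_def
  proof (rule measure_eq_AE)
    show "AE \<omega> in ?E. (\<omega> \<in> {\<omega>. ?run \<omega> \<and> ?acc \<omega>}) = (\<omega> \<in> {\<omega>. ?acc \<omega>})"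
      using AE_executions_dra_run by eventually_elim simp
    show "{\<omega>. ?run \<omega> \<and> ?acc \<omega>} \<in> sets ?E"
      unfolding executions_def by (intro sets_Collect_path pred_intros_logic run acc)
    show "{\<omega>. ?acc \<omega>} \<in> sets ?E"
      unfolding executions_def by (rule sets_Collect_path[OF acc])
  qed
  also have "\<dots> = measure (distr ?E ?\<Pi> ?f) {\<omega>. rabin_accepting (g_pairs ?G) (\<lambda>n. fst (\<omega> n))}"
  proof (subst measure_distr)
    show "?f \<in> measurable ?E ?\<Pi>"
    proof -
      have "?f \<in> measurable ?\<Pi> ?\<Pi>"
      proof (rule measurable_PiM_single')
        show "?f \<in> space ?\<Pi> \<rightarrow> (UNIV \<rightarrow>\<^sub>E space (count_space UNIV))"
          by (simp only: space_PiM space_count_space PiE_UNIV) auto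
        show "(\<lambda>\<omega>. (st_state (\<omega> n), st_gd (\<omega> n), st_ga (\<omega> n))) \<in> measurable ?\<Pi> (count_space UNIV)" for n :: nat
          by (rule measurable_compose[OF measurable_path_coord measurable_count_space])
      qed
      then show ?thesis
        by (simp add: executions_def measurable_cong_sets[OF sets_path_measure refl])
    qed
    have "Measurable.pred ?\<Pi> (\<lambda>\<omega> :: nat \<Rightarrow> ('s \<times> 'q) \<times> nat \<times> nat. rabin_accepting (g_pairs ?G) (\<lambda>n. fst (\<omega> n)))"
      by (rule pred_rabin_accepting) simp
    then show "{\<omega> :: nat \<Rightarrow> ('s \<times> 'q) \<times> nat \<times> nat. rabin_accepting (g_pairs ?G) (\<lambda>n. fst (\<omega> n))} \<in> sets ?\<Pi>"
      by (simp add: pred_def space_PiM)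
  qed (simp add: vimage_def rabin_accepting_product_game executions_def)
  finally show ?thesis
    by (simp add: distr_executions gmc_sat_prob_def)
qed

theorem mainTheorem2:
  fixes G :: "('s::finite, 'ud::finite, 'ua::finite, 'od::finite, 'oa::finite, 'ap) posg"
    and A :: "('q::finite, 'ap) dra"
    and \<phi> :: "'ap ltl"
  assumes "dra_represents A \<phi>"
  shows "(SUP Cd\<in>FSC. INF Ca\<in>FSC. gmc_sat_prob (product_game G A) Cd Ca) =
           (SUP Cd\<in>FSC. INF Ca\<in>FSC. exec_sat_prob G A Cd Ca) \<and>
         (SUP Cd\<in>FSC. INF Ca\<in>FSC. exec_sat_prob G A Cd Ca) =
           (SUP Cd\<in>FSC. INF Ca\<in>FSC.
              \<Sum>R\<in>rec_sets (product_game G A) Cd Ca. reach_prob (product_game G A) Cd Ca R)"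
  \<comment> \<open>The congruence rules provide \<open>Cd \<in> FSC\<close> and
    \<open>Ca \<in> FSC\<close>, which the reachability formula assumes.\<close>
  by (simp add: exec_sat_prob_eq_gmc_sat_prob gmc_sat_prob_eq_reach cong: SUP_cong INF_cong)

end
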